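(* Let $n,C\in\mathbb Z_{\ge1}$ and let $\pi_{\mathsf{FA}}\in\Pi_{\mathsf{FA}}$ be any fair allocation policy. Write $n\wedge C=\min\{n,C\}$. (a) (Competitive ratio) $$\sup_{L\in\mathbb Z_{\ge1}^n}\frac{T^{\pi_{\mathsf{FA}}}(L)}{\left\lceil\frac1C\sum_{i=1}^nL_i\right\rceil}\le 1+\frac{C\ln(n\wedge C)+2C}{n}.$$ (b) (Performance ratio) For every $q\in[0,1)^n$, $$\frac{\mathbb E[T^{\pi_{\mathsf{FA}}}]}{\mathbb E[T^*]}\le1+\frac{C\ln(n\wedge C)+2C}{\sum_{i=1}^n\frac1{1-q_i}}.$$ (c) If $0<\underline q<\bar q<1$, then $$\sup_{q\in[\underline q,\bar q]^n}\frac{\mathbb E[T^{\pi_{\mathsf{FA}}}]}{\mathbb E[T^*]}\le\left\lceil\frac{\ln\underline q}{\ln\bar q}\right\rceil.$$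
   Context: Model. An instance has $n\ge1$ threats $[n]=\{1,\dots,n\}$, a per-round capacity $C\in\mathbb Z_{\ge1}$ of effectors, and difficulties $q=(q_i)\in[0,1)^n$, where $q_i$ is the probability that a single effector fails to neutralize threat $i$. Demands $L_1,\dots,L_n$ are independent, $L_i\sim\mathrm{Geom}(1-q_i)$ on $\{1,2,\dots\}$, i.e. $\Pr(L_i>k)=q_i^k$ (with $0^0=1$). $\mathcal M_t\subseteq[n]$ is the set of active threats at the start of round $t$, $\mathcal M_1=[n]$. A policy is $\pi=(\pi_t)_{t\ge1}$, where $\pi_t$ maps each subset $\mathcal M\subseteq[n]$ to a vector $\pi_t(\mathcal M)\in\mathbb Z_{\ge0}^n$ with $\sum_{i\in[n]}[\pi_t(\mathcal M)]_i\le C$ and, for every nonempty $\mathcal M$ and every $t$, $\sum_{i\in\mathcal M}[\pi_t(\mathcal M)]_i=C$; $\Pi$ is the set of all such policies. Under $\pi$, the round-$t$ allocation is $x^t=\pi_t(\mathcal M_t)$ and $\mathcal M_{t+1}=\{i\in\mathcal M_t:\sum_{\ell=1}^t x_i^\ell<L_i\}$. Defusing time. $T^\pi=\min\{t:\sum_{\ell=1}^t x_i^\ell\ge L_i\ \forall i\in[n]\}$; for a fixed realization $L\in\mathbb Z_{\ge1}^n$ of the demands, $T^\pi(L)$ denotes its value. $\mathbb E[T^*]=\min_{\pi\in\Pi}\mathbb E[T^\pi]$, expectations being over the geometric demands for the given $q$. Fair allocation. For nonempty $\mathcal M\subseteq[n]$, $x\in\mathbb Z_{\ge0}^n$ is fair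 for $\mathcal M$ if $\sum_{i\in\mathcal M}x_i=C$, $x_i=0$ for $i\notin\mathcal M$, and $|x_i-x_j|\in\{0,1\}$ for all $i,j\in\mathcal M$. $\Pi_{\mathsf{FA}}$ is the set of $\pi\in\Pi$ such that $\pi_t(\mathcal M)$ is fair for $\mathcal M$ for every nonempty $\mathcal M\subseteq[n]$ and every $t\ge1$. *)

theory Defs
  imports "HOL-Probability.Probability" "HOL-Probability.Product_PMF"
begin

text \<open>
  Threats are the naturals \<open>1, \<dots>, n\<close>; an allocation is a function \<open>nat \<Rightarrow> nat\<close> of which only the
  values on \<open>{1..n}\<close> matter. A policy \<open>\<pi>\<close> is applied as \<open>\<pi> t M i\<close> (round \<open>t \<ge> 1\<close>, active set \<open>M\<close>,
  threat \<open>i\<close>).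
\<close>

type_synonym policy = "nat \<Rightarrow> nat set \<Rightarrow> nat \<Rightarrow> nat"

definition policies :: "nat \<Rightarrow> nat \<Rightarrow> policy set" where
  "policies n C = {\<pi>. \<forall>t\<ge>1. \<forall>M\<subseteq>{1..n}.
     (\<Sum>i\<in>{1..n}. \<pi> t M i) \<le> C \<and> (M \<noteq> {} \<longrightarrow> (\<Sum>i\<in>M. \<pi> t M i) = C)}"

definition fair :: "nat \<Rightarrow> nat \<Rightarrow> nat set \<Rightarrow> (nat \<Rightarrow> nat) \<Rightarrow> bool" where
  "fair n C M x \<longleftrightarrow> (\<Sum>i\<in>M. x i) = C \<and> (\<forall>i\<in>{1..n} - M. x i = 0) \<and>
     (\<forall>i\<in>M. \<forall>j\<in>M. \<bar>int (x i) - int (x j)\<bar> \<in> {0, 1})"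

definition fair_policies :: "nat \<Rightarrow> nat \<Rightarrow> policy set" where
  "fair_policies n C = {\<pi> \<in> policies n C. \<forall>t\<ge>1. \<forall>M\<subseteq>{1..n}. M \<noteq> {} \<longrightarrow> fair n C M (\<pi> t M)}"

text \<open>
  Rounds are numbered from 1; the value of \<open>active\<close> at 0 is a dummy.
\<close>

fun active :: "nat \<Rightarrow> policy \<Rightarrow> (nat \<Rightarrow> nat) \<Rightarrow> nat \<Rightarrow> nat set" where
  "active n \<pi> L 0 = {1..n}"
| "active n \<pi> L (Suc 0) = {1..n}"
| "active n \<pi> L (Suc (Suc t)) =
     {i \<in> active n \<pi> L (Suc t). (\<Sum>l=1..Suc t. \<pi> l (active n \<pi> L l) i) < L i}"

definition alloc :: "nat \<Rightarrow> policy \<Rightarrow> (nat \<Rightarrow> nat) \<Rightarrow> nat \<Rightarrow> nat \<Rightarrow> nat" where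
  "alloc n \<pi> L t = \<pi> t (active n \<pi> L t)"

definition defused :: "nat \<Rightarrow> policy \<Rightarrow> (nat \<Rightarrow> nat) \<Rightarrow> nat \<Rightarrow> bool" where
  "defused n \<pi> L t \<longleftrightarrow> (\<forall>i\<in>{1..n}. L i \<le> (\<Sum>l=1..t. alloc n \<pi> L l i))"

definition defusing_time :: "nat \<Rightarrow> policy \<Rightarrow> (nat \<Rightarrow> nat) \<Rightarrow> nat" where
  "defusing_time n \<pi> L = (LEAST t. defused n \<pi> L t)"

text \<open>
  \<open>geometric_pmf p\<close> counts the failures before the first success and so lives on \<open>{0, 1, \<dots>}\<close>;
  hence the shift by \<open>Suc\<close>. Coordinates outside \<open>{1..n}\<close> are irrelevant and set to 1.
\<close>

definition demand_pmf :: "nat \<Rightarrow> (nat \<Rightarrow> real) \<Rightarrow> (nat \<Rightarrow> nat) pmf" where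
  "demand_pmf n q = Pi_pmf {1..n} 1 (\<lambda>i. map_pmf Suc (geometric_pmf (1 - q i)))"

text \<open>
  For every policy the defusing time is at most \<open>\<Sum>i=1..n. L i\<close> (lemma \<open>defusing_time_le\<close> below),
  so it is integrable and this is the true expectation.
\<close>

definition expected_time :: "nat \<Rightarrow> policy \<Rightarrow> (nat \<Rightarrow> real) \<Rightarrow> real" where
  "expected_time n \<pi> q = measure_pmf.expectation (demand_pmf n q) (\<lambda>L. real (defusing_time n \<pi> L))"

text \<open>
  The minimum over all policies, written as an infimum (over a nonempty set of nonnegative reals)
  so that no attainment has to be presupposed.
\<close>

definition optimal_time :: "nat \<Rightarrow> nat \<Rightarrow> (nat \<Rightarrow> real) \<Rightarrow> real" where
  "optimal_time n C q = (INF \<pi>\<in>policies n C. expected_time n \<pi> q)"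

lemma prob_demand_gt:
  assumes "i \<in> {1..n}" "0 \<le> q i" "q i < 1"
  shows "measure_pmf.prob (demand_pmf n q) {L. L i > k} = q i ^ k"
proof -
  let ?p = "geometric_pmf (1 - q i)"
  have p: "pmf ?p m = q i ^ m * (1 - q i)" for m
    using assms by simp
  have "measure_pmf.prob (demand_pmf n q) {L. L i > k} =
      measure_pmf.prob (map_pmf (\<lambda>L. L i) (demand_pmf n q)) {k<..}"
    by (simp add: vimage_def)
  also have "map_pmf (\<lambda>L. L i) (demand_pmf n q) = map_pmf Suc ?p"
    unfolding demand_pmf_def using assms by (subst Pi_pmf_component) auto
  also have "measure_pmf.prob (map_pmf Suc ?p) {k<..} = measure_pmf.prob ?p (- {..<k})"
    by (simp, intro arg_cong[where f = "measure_pmf.prob ?p"]) auto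
  also have "\<dots> = 1 - measure_pmf.prob ?p {..<k}"
    using measure_pmf.prob_compl[of "{..<k}" ?p] by (simp add: Compl_eq_Diff_UNIV)
  also have "measure_pmf.prob ?p {..<k} = (\<Sum>m<k. q i ^ m * (1 - q i))"
    by (simp add: measure_measure_pmf_finite p)
  also have "\<dots> = 1 - q i ^ k"
    by (induction k) (simp_all add: algebra_simps)
  finally show ?thesis by simp
qed

lemma active_Suc:
  assumes "\<forall>i\<in>{1..n}. 1 \<le> L i"
  shows "active n \<pi> L (Suc t) = {i\<in>{1..n}. (\<Sum>l=1..t. alloc n \<pi> L l i) < L i}"
proof (induction t)
  case 0
  then show ?case using assms by force
next
  case (Suc t)
  have "active n \<pi> L (Suc (Suc t)) =
      {i \<in> active n \<pi> L (Suc t). (\<Sum>l=1..Suc t. alloc n \<pi> L l i) < L i}"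
    by (simp only: active.simps alloc_def)
  also have "\<dots> = {i\<in>{1..n}. (\<Sum>l=1..Suc t. alloc n \<pi> L l i) < L i}"
    unfolding Suc.IH by auto
  finally show ?case .
qed

lemma defused_bound:
  assumes "\<pi> \<in> policies n C" "C \<ge> 1" "\<forall>i\<in>{1..n}. 1 \<le> L i"
  shows "\<exists>t\<le>(\<Sum>i\<in>{1..n}. L i). defused n \<pi> L t"
proof (rule ccontr)
  assume "\<not> ?thesis"
  hence nd: "\<not> defused n \<pi> L t" if "t \<le> (\<Sum>i\<in>{1..n}. L i)" for t
    using that by blast
  let ?c = "\<lambda>t i. \<Sum>l=1..t. alloc n \<pi> L l i"
  let ?m = "\<lambda>t. \<Sum>i\<in>{1..n}. min (?c t i) (L i)"
  have "t \<le> ?m t" if "t \<le> Suc (\<Sum>i\<in>{1..n}. L i)" for t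
    using that
  proof (induction t)
    case (Suc t)
    let ?A = "active n \<pi> L (Suc t)"
    have A: "?A = {i\<in>{1..n}. ?c t i < L i}"
      by (rule active_Suc[OF assms(3)])
    have "\<not> defused n \<pi> L t" using nd Suc.prems by simp
    hence ne: "?A \<noteq> {}" unfolding A defused_def by force
    have sub: "?A \<subseteq> {1..n}" unfolding A by auto
    have "(\<Sum>i\<in>?A. alloc n \<pi> L (Suc t) i) = C"
      using assms(1) ne sub unfolding policies_def alloc_def by auto
    with assms(2) obtain j where j: "j \<in> ?A" "alloc n \<pi> L (Suc t) j \<noteq> 0"
      by (metis not_one_le_zero sum.neutral)
    have "?m t < ?m (Suc t)"
    proof (rule sum_strict_mono_ex1)
      show "\<exists>i\<in>{1..n}. min (?c t i) (L i) < min (?c (Suc t) i) (L i)"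
        using j unfolding A by (intro bexI[of _ j]) auto
    qed auto
    with Suc show ?case by simp
  qed simp
  from this[of "Suc (\<Sum>i\<in>{1..n}. L i)"]
  have "Suc (\<Sum>i\<in>{1..n}. L i) \<le> ?m (Suc (\<Sum>i\<in>{1..n}. L i))" by blast
  also have "\<dots> \<le> (\<Sum>i\<in>{1..n}. L i)" by (intro sum_mono) auto
  finally show False by simp
qed

lemma defusing_time_le:
  assumes "\<pi> \<in> policies n C" "C \<ge> 1" "\<forall>i\<in>{1..n}. 1 \<le> L i"
  shows "defused n \<pi> L (defusing_time n \<pi> L)" "defusing_time n \<pi> L \<le> (\<Sum>i\<in>{1..n}. L i)"
  using defused_bound[OF assms] unfolding defusing_time_def
  by (auto intro: LeastI order_trans[OF Least_le])

end

theory Submission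
  imports Defs
begin


text \<open>
  For (a) and (b), a fair policy wastes effectors only on threats that are neutralized in the very round
  in which they are overserved. With \<open>m\<close> threats active this excess is at most \<open>(C - 1) / m\<close> per threat,
  and it vanishes for \<open>m > C\<close>, so \<open>C * T\<close> exceeds the total demand by at most \<open>C - 1\<close> times the harmonic
  number of \<open>min n C\<close>, whereas no policy can finish before \<open>C * T\<close> reaches the total demand.

  For (c), let \<open>v m\<close> be the expected time of a fair policy for \<open>m\<close> threats of common difficulty \<open>qu\<close>.
  Moving an effector from a threat with more effectors to one with fewer keeps the probability that both
  survive and lowers the probability that at least one does. Hence balanced allocations minimize the
  expectation of every increasing function of the number of survivors; this makes \<open>v\<close> increasing and the
  fair policy optimal for common difficulties. Comparing survival probabilities round by round, the fair
  policy takes expected time at most \<open>v n\<close>. Conversely, with \<open>K = \<lceil>ln ql / ln qu\<rceil>\<close> we have \<open>qu ^ K \<le> ql\<close>, so one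
  round of any policy neutralizes no more threats than \<open>K\<close> rounds of the same allocation at difficulty
  \<open>qu\<close>, and \<open>v n\<close> is at most \<open>K\<close> times the expected time of that policy.
\<close>

section \<open>Random sets of surviving threats and means over them\<close>

text \<open>Here \<open>p i\<close> is the probability that threat \<open>i\<close> stays active; a
  round with allocation \<open>x\<close> corresponds to \<open>p i = q i ^ x i\<close>.\<close>

definition survivors :: "('a \<Rightarrow> real) \<Rightarrow> 'a set \<Rightarrow> 'a set pmf" where
  "survivors p M = map_pmf (\<lambda>b. {i \<in> M. b i}) (Pi_pmf M False (\<lambda>i. bernoulli_pmf (p i)))"

abbreviation surv_mean :: "('a \<Rightarrow> real) \<Rightarrow> 'a set \<Rightarrow> ('a set \<Rightarrow> real) \<Rightarrow> real" where
  "surv_mean p M \<equiv> measure_pmf.expectation (survivors p M)"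

lemma set_survivors: "set_pmf (survivors p M) \<subseteq> Pow M"
  by (auto simp: survivors_def)

lemma finite_set_survivors: "finite M \<Longrightarrow> finite (set_pmf (survivors p M))"
  by (rule finite_subset[OF set_survivors]) simp

lemma integrable_survivors [simp]:
  "finite M \<Longrightarrow> integrable (survivors p M) (f :: _ \<Rightarrow> real)"
  by (simp add: integrable_measure_pmf_finite finite_set_survivors)

lemma survivors_empty [simp]: "survivors p {} = return_pmf {}"
  by (simp add: survivors_def)

lemma survivors_insert:
  assumes "finite M" "i \<notin> M"
  shows "survivors p (insert i M) = bernoulli_pmf (p i) \<bind>
    (\<lambda>b. map_pmf (\<lambda>B. if b then insert i B else B) (survivors p M))"
  unfolding survivors_def Pi_pmf_insert[OF assms] pair_pmf_def map_pmf_def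
  using assms(2)
  by (auto simp: bind_assoc_pmf bind_return_pmf intro!: bind_pmf_cong refl arg_cong[where f = return_pmf]
      split: if_splits)

lemma surv_mean_insert:
  assumes "finite M" "i \<notin> M" "0 \<le> p i" "p i \<le> 1"
  shows "surv_mean p (insert i M) f =
    p i * surv_mean p M (\<lambda>B. f (insert i B)) + (1 - p i) * surv_mean p M f"
proof -
  have "surv_mean p (insert i M) f = (\<Sum>b\<in>UNIV. pmf (bernoulli_pmf (p i)) b *\<^sub>R
      measure_pmf.expectation (map_pmf (\<lambda>B. if b then insert i B else B) (survivors p M)) f)"
    unfolding survivors_insert[OF assms(1,2)]
    by (rule pmf_expectation_bind) (auto simp: finite_set_survivors assms)
  then show ?thesis using assms by (simp add: UNIV_bool)
qed

lemma surv_mean_cong: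
  assumes "finite M" "\<And>B. B \<subseteq> M \<Longrightarrow> f B = g B"
  shows "surv_mean p M f = surv_mean p M g"
  using set_survivors[of p M] assms
  by (intro integral_cong_AE) (auto simp: AE_measure_pmf_iff)

lemma surv_mean_mono:
  assumes "finite M" "\<And>B. B \<subseteq> M \<Longrightarrow> f B \<le> g B"
  shows "surv_mean p M f \<le> surv_mean p M g"
  using set_survivors[of p M] assms
  by (intro integral_mono_AE) (auto simp: AE_measure_pmf_iff)

lemma survivors_cong:
  assumes "finite M" "\<And>i. i \<in> M \<Longrightarrow> p i = p' i"
  shows "survivors p M = survivors p' M"
  unfolding survivors_def using assms by (auto intro!: arg_cong2[where f = map_pmf] Pi_pmf_cong)

lemma surv_mean_one: "finite M \<Longrightarrow> surv_mean (\<lambda>_. 1) M f = f M"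
  by (induction M arbitrary: f rule: finite_induct) (simp_all add: surv_mean_insert)

text \<open>A threat passes two successive thinnings iff both of its independent coins say so, hence
  with the product probability. This later merges several rounds with the same allocation into
  one.\<close>

lemma surv_mean_mult:
  assumes "finite M" "\<And>i. i \<in> M \<Longrightarrow> p i \<in> {0..1}" "\<And>i. i \<in> M \<Longrightarrow> p' i \<in> {0..1}"
  shows "surv_mean p M (\<lambda>B. surv_mean p' B f) = surv_mean (\<lambda>i. p i * p' i) M f"
  using assms
proof (induction M arbitrary: f rule: finite_induct)
  case (insert i M)
  have p: "0 \<le> p i" "p i \<le> 1" "0 \<le> p' i" "p' i \<le> 1" "p i * p' i \<le> 1" "0 \<le> p i * p' i"
    using insert.prems by (auto intro: mult_le_one)
  have IH: "surv_mean p M (\<lambda>B. surv_mean p' B f) = surv_mean (\<lambda>i. p i * p' i) M f" for f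
    using insert by auto
  have "surv_mean p M (\<lambda>B. surv_mean p' (insert i B) f) =
      surv_mean p M (\<lambda>B. p' i * surv_mean p' B (\<lambda>B. f (insert i B)) + (1 - p' i) * surv_mean p' B f)"
    using insert.hyps p
    by (intro surv_mean_cong) (auto intro!: surv_mean_insert dest: finite_subset)
  also have "\<dots> = p' i * surv_mean (\<lambda>i. p i * p' i) M (\<lambda>B. f (insert i B))
      + (1 - p' i) * surv_mean (\<lambda>i. p i * p' i) M f"
    using insert.hyps by (simp add: IH)
  finally show ?case
    using p insert.hyps by (simp add: surv_mean_insert IH) (simp add: algebra_simps)
qed simp

lemma surv_mean_card_insert:
  assumes "finite M" "i \<notin> M" "0 \<le> p i" "p i \<le> 1"
  shows "surv_mean p (insert i M) (\<lambda>B. g (card B)) =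
    p i * surv_mean p M (\<lambda>B. g (Suc (card B))) + (1 - p i) * surv_mean p M (\<lambda>B. g (card B))"
proof -
  have "surv_mean p M (\<lambda>B. g (card (insert i B))) = surv_mean p M (\<lambda>B. g (Suc (card B)))"
    using assms by (intro surv_mean_cong) (auto simp: finite_subset card_insert_if)
  then show ?thesis using assms by (simp add: surv_mean_insert)
qed

lemma surv_mean_all:
  assumes "finite M" "\<And>i. i \<in> M \<Longrightarrow> p i \<in> {0..1}"
  shows "surv_mean p M (\<lambda>B. if card B = card M then 1 else 0) = (\<Prod>i\<in>M. p i)"
  using assms
proof (induction M rule: finite_induct)
  case (insert i M)
  have "surv_mean p M (\<lambda>B. if card B = Suc (card M) then 1 else 0) = surv_mean p M (\<lambda>_. 0)"
    using insert.hyps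
    by (intro surv_mean_cong) (auto dest!: card_mono[OF \<open>finite M\<close>])
  then show ?case using insert surv_mean_card_insert[of M i p "\<lambda>k. if k = Suc (card M) then 1 else 0"]
    by simp
qed simp

lemma surv_mean_reindex:
  assumes "finite M" "inj_on h M" "\<And>i. i \<in> M \<Longrightarrow> p (h i) \<in> {0..1}"
  shows "surv_mean p (h ` M) (\<lambda>B. g (card B)) = surv_mean (\<lambda>i. p (h i)) M (\<lambda>B. g (card B))"
  using assms
proof (induction M arbitrary: g rule: finite_induct)
  case (insert i M)
  have "h i \<notin> h ` M" using insert by auto
  then have "surv_mean p (h ` insert i M) (\<lambda>B. g (card B)) =
    p (h i) * surv_mean p (h ` M) (\<lambda>B. g (Suc (card B))) + (1 - p (h i)) * surv_mean p (h ` M) (\<lambda>B. g (card B))"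
    using insert surv_mean_card_insert[of "h ` M" "h i" p g] by simp
  also have "\<dots> = surv_mean (\<lambda>i. p (h i)) (insert i M) (\<lambda>B. g (card B))"
    using insert surv_mean_card_insert[of M i "\<lambda>i. p (h i)" g] insert.IH[of "\<lambda>k. g (Suc k)"]
      insert.IH[of g] by (simp add: inj_on_insert)
  finally show ?case .
qed simp

text \<open>The mean is affine in the single probability of \<open>i\<close>, and its slope is
  nonnegative because one more survivor cannot lower \<open>g\<close>; the other threats are handled
  by induction.\<close>

lemma surv_mean_mono_prob:
  fixes g :: "nat \<Rightarrow> real"
  assumes "finite M" "\<And>i. i \<in> M \<Longrightarrow> p i \<in> {0..1}" "\<And>i. i \<in> M \<Longrightarrow> p' i \<in> {0..1}"
    "\<And>i. i \<in> M \<Longrightarrow> p i \<le> p' i" "mono g"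
  shows "surv_mean p M (\<lambda>B. g (card B)) \<le> surv_mean p' M (\<lambda>B. g (card B))"
  using assms
proof (induction M arbitrary: g rule: finite_induct)
  case (insert i M)
  let ?a = "surv_mean p M (\<lambda>B. g (Suc (card B)))" and ?a' = "surv_mean p' M (\<lambda>B. g (Suc (card B)))"
  let ?b = "surv_mean p M (\<lambda>B. g (card B))" and ?b' = "surv_mean p' M (\<lambda>B. g (card B))"
  have g: "mono (\<lambda>k. g (Suc k))" using \<open>mono g\<close> by (auto simp: mono_def)
  have "?a \<le> ?a'" "?b \<le> ?b'"
    using insert.IH[OF _ _ _ g] insert.IH[OF _ _ _ \<open>mono g\<close>] insert.prems by auto
  moreover have "?b' \<le> ?a'"
    using insert.hyps \<open>mono g\<close> by (intro surv_mean_mono) (auto simp: mono_def)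
  moreover have p: "0 \<le> p i" "p i \<le> p' i" "p' i \<le> 1" using insert.prems by auto
  ultimately have "p i * ?a + (1 - p i) * ?b \<le> p i * ?a' + (1 - p i) * ?b'"
    by (intro add_mono mult_left_mono) auto
  also have "\<dots> = ?b' + p i * (?a' - ?b')" by (simp add: algebra_simps)
  also have "\<dots> \<le> ?b' + p' i * (?a' - ?b')"
    using p \<open>?b' \<le> ?a'\<close> by (intro add_left_mono mult_right_mono) auto
  finally show ?case
    using insert.hyps p by (simp add: surv_mean_card_insert algebra_simps)
qed simp

text \<open>The threats of \<open>M - A\<close> are joined one at a time; each adds 0 or 1 to the
  number of survivors.\<close>

lemma surv_mean_mono_set:
  fixes g :: "nat \<Rightarrow> real"
  assumes "finite M" "A \<subseteq> M" "\<And>i. i \<in> M \<Longrightarrow> p i \<in> {0..1}" "mono g"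
  shows "surv_mean p A (\<lambda>B. g (card B)) \<le> surv_mean p M (\<lambda>B. g (card B))"
proof -
  have "finite (M - A)" using assms(1) by simp
  then have "D \<subseteq> M - A \<Longrightarrow> finite D \<Longrightarrow> 
      surv_mean p A (\<lambda>B. g (card B)) \<le> surv_mean p (A \<union> D) (\<lambda>B. g (card B))" for D
  proof (induction D rule: infinite_finite_induct)
    case (insert i D)
    have *: "finite (A \<union> D)" "i \<notin> A \<union> D" "0 \<le> p i" "p i \<le> 1"
      using insert assms finite_subset[OF assms(2,1)] by auto
    have "surv_mean p (A \<union> D) (\<lambda>B. g (card B)) \<le> surv_mean p (A \<union> D) (\<lambda>B. g (Suc (card B)))"
      using * \<open>mono g\<close> by (intro surv_mean_mono) (auto simp: mono_def)
    then have "p i * surv_mean p (A \<union> D) (\<lambda>B. g (card B)) \<le> p i * surv_mean p (A \<union> D) (\<lambda>B. g (Suc (card B)))"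
      using * by (intro mult_left_mono) auto
    then have "surv_mean p (A \<union> D) (\<lambda>B. g (card B)) \<le> surv_mean p (A \<union> insert i D) (\<lambda>B. g (card B))"
      using * surv_mean_card_insert[of "A \<union> D" i p g] by (simp add: algebra_simps)
    then show ?case using insert by auto
  qed auto
  from this[of "M - A"] show ?thesis using assms by (simp add: Un_absorb1 Un_Diff_cancel)
qed


section \<open>Balanced allocations and the exchange argument\<close>

text \<open>A canonical fair allocation on \<open>{..<m}\<close>: it lets the cost of a fair round
  be expressed through the number of active threats alone.\<close>

definition balanced :: "nat \<Rightarrow> nat \<Rightarrow> nat \<Rightarrow> nat" where
  "balanced C m i = C div m + (if i < C mod m then 1 else 0)"

lemma sum_balanced: "m > 0 \<Longrightarrow> (\<Sum>i<m. balanced C m i) = C"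
proof -
  assume "m > 0"
  have "(\<Sum>i<m. balanced C m i) = m * (C div m) + card ({..<m} \<inter> {i. i < C mod m})"
    by (simp add: balanced_def sum.distrib sum.If_cases)
  also have "{..<m} \<inter> {i. i < C mod m} = {..<C mod m}"
    using \<open>m > 0\<close> by (auto intro: less_trans[OF _ mod_less_divisor])
  finally show ?thesis by simp
qed

lemma surv_mean_exchange:
  fixes g :: "nat \<Rightarrow> real" and q :: real
  assumes "finite M" "i \<in> M" "j \<in> M" "i \<noteq> j" "mono g" "0 \<le> q" "q \<le> 1" "x j < x i"
  shows "surv_mean (\<lambda>k. q ^ (x(i := x i - 1, j := Suc (x j))) k) M (\<lambda>B. g (card B))
    \<le> surv_mean (\<lambda>k. q ^ x k) M (\<lambda>B. g (card B))"
proof -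
  define N where "N = M - {i, j}"
  have N: "finite N" "i \<notin> N" "j \<notin> N" "M = insert i (insert j N)"
    using assms unfolding N_def by auto
  \<comment> \<open>\<open>e k\<close> is the mean when exactly \<open>k\<close> of the two threats
    \<open>i\<close> and \<open>j\<close> survive.\<close>
  define e where "e k = surv_mean (\<lambda>k. q ^ x k) N (\<lambda>B. g (k + card B))" for k
  \<comment> \<open>As a polynomial in the survival probabilities of \<open>i\<close> and
    \<open>j\<close>, the mean involves only their sum and their product. The exchange preserves the
    product, so only the sum, with coefficient \<open>e 1 - e 0\<close>, has to be compared.\<close>
  have expand: "surv_mean (\<lambda>k. q ^ y k) M (\<lambda>B. g (card B)) =
      e 0 + (q ^ y i + q ^ y j) * (e 1 - e 0) + q ^ (y i + y j) * (e 2 - 2 * e 1 + e 0)"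
    if y: "\<And>k. k \<in> N \<Longrightarrow> y k = x k" for y
  proof -
    have "surv_mean (\<lambda>k. q ^ y k) N (\<lambda>B. g (k + card B)) = e k" for k
      unfolding e_def using y N by (subst survivors_cong[of N _ "\<lambda>k. q ^ x k"]) auto
    from this[of 0] this[of 1] this[of 2] show ?thesis
      using N assms(4,6,7) unfolding N(4)
      by (simp add: surv_mean_card_insert surv_mean_card_insert[where g = "\<lambda>k. g (Suc k)"] power_le_one
          algebra_simps power_add)
  qed
  have "e 0 \<le> e 1"
    unfolding e_def using \<open>mono g\<close> N by (intro surv_mean_mono) (auto simp: mono_def)
  moreover have "q ^ (x i - 1) + q ^ Suc (x j) \<le> q ^ x i + q ^ x j"
  proof -
    obtain d where d: "x i = Suc (x j + d)" using assms(8) less_imp_Suc_add by blast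
    \<comment> \<open>This is exactly the amount by which the exchange lowers the sum of the two
      survival probabilities.\<close>
    have "0 \<le> q ^ x j * ((1 - q) * (1 - q ^ d))"
      using assms by (intro mult_nonneg_nonneg) (auto simp: power_le_one)
    then show ?thesis by (simp add: d power_add algebra_simps)
  qed
  moreover have "x i - 1 + Suc (x j) = x i + x j" using assms(8) by simp
  ultimately show ?thesis
    using assms(4) N by (subst (1 2) expand) (auto intro!: mult_right_mono)
qed

text \<open>Induction on the distance between the two allocations; exchange moves towards the balanced one.\<close>

lemma surv_mean_balanced_le:
  fixes g :: "nat \<Rightarrow> real" and q :: real and x y :: "'a \<Rightarrow> nat"
  assumes "finite M" "mono g" "0 \<le> q" "q \<le> 1"
    "(\<Sum>i\<in>M. x i) \<le> (\<Sum>i\<in>M. y i)" "\<And>i j. i \<in> M \<Longrightarrow> j \<in> M \<Longrightarrow> y i \<le> Suc (y j)"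
  shows "surv_mean (\<lambda>k. q ^ y k) M (\<lambda>B. g (card B)) \<le> surv_mean (\<lambda>k. q ^ x k) M (\<lambda>B. g (card B))"
  using assms(5)
proof (induction "\<Sum>i\<in>M. nat \<bar>int (x i) - int (y i)\<bar>" arbitrary: x rule: less_induct)
  case less
  let ?d = "\<lambda>x i. nat \<bar>int (x i) - int (y i)\<bar>"
  show ?case
  proof (cases "\<exists>i\<in>M. x i < y i")
    case False
    \<comment> \<open>Here \<open>x\<close> dominates \<open>y\<close> pointwise without a larger
      total, so the two agree on \<open>M\<close>.\<close>
    then have "\<forall>i\<in>M. y i \<le> x i" by auto
    moreover from this have "(\<Sum>i\<in>M. x i) = (\<Sum>i\<in>M. y i)"
      using less.prems sum_mono[of M y x] by auto
    ultimately have "\<forall>i\<in>M. x i = y i"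
      using sum_mono_inv[of y M x] assms(1) by metis
    then show ?thesis using assms(1) survivors_cong[of M "\<lambda>k. q ^ x k" "\<lambda>k. q ^ y k"] by simp
  next
    case True
    then obtain j where j: "j \<in> M" "x j < y j" by blast
    have le: "(\<Sum>i\<in>M. ?d x' i) < (\<Sum>i\<in>M. ?d x i)"
      if "\<And>i. i \<in> M \<Longrightarrow> ?d x' i \<le> ?d x i" "?d x' j < ?d x j" for x'
      using that assms(1) j by (intro sum_strict_mono_ex1 bexI[of _ j] ballI) blast+
    show ?thesis
    proof (cases "(\<Sum>i\<in>M. x i) < (\<Sum>i\<in>M. y i)")
      case True
      \<comment> \<open>There is slack in the total, so \<open>j\<close> simply receives one more
        effector, which lowers its survival probability.\<close>
      let ?x = "x(j := Suc (x j))"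
      have "(\<Sum>i\<in>M. ?x i) = Suc (\<Sum>i\<in>M. x i)"
        using assms(1) j by (simp add: sum.remove[of M j])
      then have "surv_mean (\<lambda>k. q ^ y k) M (\<lambda>B. g (card B)) \<le> surv_mean (\<lambda>k. q ^ ?x k) M (\<lambda>B. g (card B))"
        using True j by (intro less.hyps le) auto
      also have "\<dots> \<le> surv_mean (\<lambda>k. q ^ x k) M (\<lambda>B. g (card B))"
        using assms
        by (intro surv_mean_mono_prob) (auto simp del: power_Suc intro: power_le_one power_decreasing)
      finally show ?thesis .
    next
      case False
      have "\<exists>i\<in>M. y i < x i"
      proof (rule ccontr)
        assume "\<not> (\<exists>i\<in>M. y i < x i)"
        then have "(\<Sum>i\<in>M. x i) < (\<Sum>i\<in>M. y i)"
          using j assms(1) by (intro sum_strict_mono_ex1) (auto simp: not_less)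
        then show False using False by simp
      qed
      then obtain i where i: "i \<in> M" "y i < x i" by blast
      \<comment> \<open>The exchange is admissible because
        \<open>x j < y j \<le> Suc (y i) \<le> x i\<close>.\<close>
      have ij: "i \<noteq> j" "x j < x i" using i j assms(6)[of j i] by auto
      let ?x = "x(i := x i - 1, j := Suc (x j))"
      have "(\<Sum>k\<in>M. ?x k) = (\<Sum>k\<in>M. x k)"
        using assms(1) i j ij by (simp add: sum.remove[of M i] sum.remove[of "M - {i}" j])
      then have "surv_mean (\<lambda>k. q ^ y k) M (\<lambda>B. g (card B)) \<le> surv_mean (\<lambda>k. q ^ ?x k) M (\<lambda>B. g (card B))"
        using less.prems i j ij by (intro less.hyps le) auto
      also have "\<dots> \<le> surv_mean (\<lambda>k. q ^ x k) M (\<lambda>B. g (card B))"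
        using assms i j ij by (intro surv_mean_exchange) auto
      finally show ?thesis .
    qed
  qed
qed

text \<open>Costs depend only on the number of survivors, so a numbering \<open>h\<close> of
  \<open>M\<close> reduces the claim to allocations on \<open>{..<card M}\<close>.\<close>

lemma surv_mean_balanced_card_le:
  fixes g :: "nat \<Rightarrow> real" and q :: real and x :: "'a \<Rightarrow> nat"
  assumes "finite M" "M \<noteq> {}" "mono g" "0 \<le> q" "q \<le> 1" "(\<Sum>i\<in>M. x i) \<le> C"
  shows "surv_mean (\<lambda>k. q ^ balanced C (card M) k) {..<card M} (\<lambda>B. g (card B))
    \<le> surv_mean (\<lambda>k. q ^ x k) M (\<lambda>B. g (card B))"
proof -
  obtain h where h: "bij_betw h {..<card M} M"
    using assms(1) bij_betw_from_nat_into_finite by blast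
  have m: "card M > 0" using assms by (simp add: card_gt_0_iff)
  have "surv_mean (\<lambda>k. q ^ balanced C (card M) k) {..<card M} (\<lambda>B. g (card B))
      \<le> surv_mean (\<lambda>k. q ^ x (h k)) {..<card M} (\<lambda>B. g (card B))"
    using assms sum_balanced[OF m, of C] sum.reindex_bij_betw[OF h, of x]
    by (intro surv_mean_balanced_le) (auto simp: balanced_def)
  also have "\<dots> = surv_mean (\<lambda>k. q ^ x k) (h ` {..<card M}) (\<lambda>B. g (card B))"
    using h assms by (intro surv_mean_reindex[symmetric]) (auto simp: bij_betw_def power_le_one)
  finally show ?thesis using h by (simp add: bij_betw_def)
qed

text \<open>Both allocations have total \<open>C\<close> and values differing by at most one, so
  each is minimal and the comparison holds in both directions.\<close>

lemma surv_mean_fair_eq: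
  fixes g :: "nat \<Rightarrow> real" and q :: real and x :: "'a \<Rightarrow> nat"
  assumes "finite M" "M \<noteq> {}" "mono g" "0 \<le> q" "q \<le> 1" "(\<Sum>i\<in>M. x i) = C"
    "\<And>i j. i \<in> M \<Longrightarrow> j \<in> M \<Longrightarrow> x i \<le> Suc (x j)"
  shows "surv_mean (\<lambda>k. q ^ x k) M (\<lambda>B. g (card B)) =
    surv_mean (\<lambda>k. q ^ balanced C (card M) k) {..<card M} (\<lambda>B. g (card B))"
proof (rule antisym)
  obtain h where h: "bij_betw h {..<card M} M"
    using assms(1) bij_betw_from_nat_into_finite by blast
  have m: "card M > 0" using assms by (simp add: card_gt_0_iff)
  have "surv_mean (\<lambda>k. q ^ x k) M (\<lambda>B. g (card B)) = 
      surv_mean (\<lambda>k. q ^ x k) (h ` {..<card M}) (\<lambda>B. g (card B))"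
    using h by (simp add: bij_betw_def)
  also have "\<dots> = surv_mean (\<lambda>k. q ^ x (h k)) {..<card M} (\<lambda>B. g (card B))"
    using h assms by (intro surv_mean_reindex) (auto simp: bij_betw_def power_le_one)
  also have "\<dots> \<le> surv_mean (\<lambda>k. q ^ balanced C (card M) k) {..<card M} (\<lambda>B. g (card B))"
    using assms sum_balanced[OF m, of C] sum.reindex_bij_betw[OF h, of x] bij_betwE[OF h]
    by (intro surv_mean_balanced_le) auto
  finally show "surv_mean (\<lambda>k. q ^ x k) M (\<lambda>B. g (card B))
    \<le> surv_mean (\<lambda>k. q ^ balanced C (card M) k) {..<card M} (\<lambda>B. g (card B))" .
qed (use assms in \<open>auto intro: surv_mean_balanced_card_le\<close>)

section \<open>The value of fair play at a common difficulty\<close>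

text \<open>
  The expected defusing time of a fair policy for \<open>m\<close> threats of common difficulty \<open>q\<close>; the
  denominator accounts for the rounds in which nothing is neutralized.
\<close>

fun fair_value :: "real \<Rightarrow> nat \<Rightarrow> nat \<Rightarrow> real" where
  "fair_value q C m = (if m = 0 then 0 else
     (1 + surv_mean (\<lambda>k. q ^ balanced C m k) {..<m}
        (\<lambda>B. if card B < m then fair_value q C (card B) else 0)) / (1 - q ^ C))"

declare fair_value.simps [simp del]

lemma fair_value_0 [simp]: "fair_value q C 0 = 0"
  by (simp add: fair_value.simps)

text \<open>The guard \<open>card B < m\<close>, which makes the recursion for
  \<open>fair_value\<close> well-founded, excludes the event that nothing is neutralized. That event
  has probability \<open>q ^ C\<close>, since the exponents sum to \<open>C\<close>.\<close>

lemma surv_mean_no_loss: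
  fixes q :: real
  assumes "0 \<le> q" "q \<le> 1" "m > 0"
  shows "surv_mean (\<lambda>k. q ^ balanced C m k) {..<m} (\<lambda>B. if card B < m then f (card B) else c) =
    surv_mean (\<lambda>k. q ^ balanced C m k) {..<m} (\<lambda>B. if card B < m then f (card B) else 0) + q ^ C * c"
proof -
  let ?E = "surv_mean (\<lambda>k. q ^ balanced C m k) {..<m}"
  have "?E (\<lambda>B. if card B < m then f (card B) else c) =
      ?E (\<lambda>B. (if card B < m then f (card B) else 0) + (if card B = m then 1 else 0) * c)"
    by (intro surv_mean_cong) (auto dest!: card_mono[rotated])
  also have "\<dots> = ?E (\<lambda>B. if card B < m then f (card B) else 0) + ?E (\<lambda>B. if card B = m then 1 else 0) * c"
    by simp
  also have "?E (\<lambda>B. if card B = m then 1 else 0) = q ^ C"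
    using assms surv_mean_all[of "{..<m}" "\<lambda>k. q ^ balanced C m k"] sum_balanced[of m C]
    by (simp add: power_le_one power_sum[symmetric])
  finally show ?thesis .
qed

text \<open>The self-referential one-step equation, obtained from the recursion by clearing the
  denominator and moving the no-loss term \<open>q ^ C * fair_value q C m\<close> to the
  right.\<close>

lemma fair_value_eq:
  assumes "0 \<le> q" "q < 1" "C \<ge> 1" "m > 0"
  shows "fair_value q C m =
    1 + surv_mean (\<lambda>k. q ^ balanced C m k) {..<m} (\<lambda>B. fair_value q C (card B))"
proof -
  let ?E = "surv_mean (\<lambda>k. q ^ balanced C m k) {..<m}"
  have qC: "q ^ C < 1" using assms by (simp add: power_less_one_iff)
  have "?E (\<lambda>B. fair_value q C (card B)) =
      ?E (\<lambda>B. if card B < m then fair_value q C (card B) else fair_value q C m)"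
    by (intro surv_mean_cong) (auto dest!: card_mono[rotated])
  also have "\<dots> = ?E (\<lambda>B. if card B < m then fair_value q C (card B) else 0) + q ^ C * fair_value q C m"
    using assms by (intro surv_mean_no_loss) auto
  finally have "?E (\<lambda>B. fair_value q C (card B)) = ?E (\<lambda>B. if card B < m then fair_value q C (card B) else 0)
      + q ^ C * fair_value q C m" .
  moreover have "(1 - q ^ C) * fair_value q C m =
      1 + ?E (\<lambda>B. if card B < m then fair_value q C (card B) else 0)"
    using qC assms(4) fair_value.simps[of q C m] by simp
  ultimately show ?thesis by (simp add: algebra_simps)
qed

text \<open>Minimality of balanced allocations needs an increasing cost, which is the very claim
  here. The induction avoids the circle by truncating the value at \<open>m\<close>, where it is
  already known to be increasing.\<close>

lemma fair_value_mono:
  assumes "0 \<le> q" "q < 1" "C \<ge> 1"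
  shows "mono (fair_value q C)"
proof -
  let ?v = "fair_value q C"
  have qC: "q ^ C < 1" using assms by (simp add: power_less_one_iff)
  have "\<forall>k l. k \<le> l \<longrightarrow> l \<le> m \<longrightarrow> ?v k \<le> ?v l" for m
  proof (induction m)
    case (Suc m)
    have "?v m \<le> ?v (Suc m)"
    proof (cases "m = 0")
      case True
      have "0 \<le> surv_mean (\<lambda>k. q ^ balanced C (Suc 0) k) {..<Suc 0}
        (\<lambda>B. if card B < Suc 0 then fair_value q C (card B) else 0)"
        by (rule Bochner_Integration.integral_nonneg) auto
      then show ?thesis using True qC fair_value.simps[of q C "Suc 0"] by simp
    next
      case False
      define g where "g k = ?v (min k m)" for k
      have g: "mono g" using Suc unfolding g_def mono_def by (auto simp: min_def)
      let ?E = "\<lambda>m. surv_mean (\<lambda>k. q ^ balanced C m k) {..<m}"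
      let ?F = "\<lambda>m. surv_mean (\<lambda>k. q ^ balanced C (Suc m) k) {..<m}"
      have "?v m = 1 + ?E m (\<lambda>B. g (card B))"
        using False assms fair_value_eq[of q C m]
        by (auto simp: g_def min_absorb1 dest!: card_mono[rotated] intro!: surv_mean_cong)
      \<comment> \<open>\<open>?F m\<close> cuts the balanced allocation for \<open>Suc m\<close>
        threats down to the first \<open>m\<close>. It uses at most \<open>C\<close> effectors, so
        the balanced one for \<open>m\<close> threats does no worse; restoring the last threat then
        only adds survivors.\<close>
      also have "?E m (\<lambda>B. g (card B)) \<le> ?F m (\<lambda>B. g (card B))"
        using surv_mean_balanced_card_le[of "{..<m}" g q "balanced C (Suc m)" C] False g assms
          sum_balanced[of "Suc m" C] by (simp add: lessThan_empty_iff)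
      also have "\<dots> \<le> ?E (Suc m) (\<lambda>B. g (card B))"
        using assms g by (intro surv_mean_mono_set) (auto intro: power_le_one)
      \<comment> \<open>If all \<open>Suc m\<close> threats survive, the truncated cost is
        \<open>?v m\<close>. Moving the resulting term \<open>q ^ C * ?v m\<close> to the left
        leaves a comparison with the positive factor \<open>1 - q ^ C\<close>.\<close>
      also have "?E (Suc m) (\<lambda>B. g (card B)) = ?E (Suc m) (\<lambda>B. if card B < Suc m then ?v (card B) else ?v m)"
        by (auto simp: g_def min_def less_Suc_eq_le dest!: card_mono[rotated] intro!: surv_mean_cong)
      also have "\<dots> = ?E (Suc m) (\<lambda>B. if card B < Suc m then ?v (card B) else 0) + q ^ C * ?v m"
        using assms by (intro surv_mean_no_loss) auto
      also have "\<dots> = (1 - q ^ C) * ?v (Suc m) - 1 + q ^ C * ?v m"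
        using qC fair_value.simps[of q C "Suc m"] by simp
      finally have "(1 - q ^ C) * ?v m \<le> (1 - q ^ C) * ?v (Suc m)" by (simp add: algebra_simps)
      then show ?thesis using qC by simp
    qed
    then show ?case using Suc by (metis le_SucE le_trans nle_le order_refl order_trans)
  qed simp
  then show ?thesis by (auto simp: mono_def)
qed

lemma fair_value_le_step:
  assumes "0 \<le> q" "q < 1" "C \<ge> 1" "finite M" "(\<Sum>i\<in>M. x i) \<le> C"
  shows "fair_value q C (card M) \<le>
    1 + surv_mean (\<lambda>k. q ^ x k) M (\<lambda>B. fair_value q C (card B))"
proof (cases "M = {}")
  case False
  then have "card M > 0" using assms(4) by (simp add: card_gt_0_iff)
  then show ?thesis
    using surv_mean_balanced_card_le[of M "fair_value q C" q x C] fair_value_mono[of q C] False assms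
      fair_value_eq[of q C "card M"] by simp
qed simp

text \<open>Iterates the one-step inequality with the allocation frozen. Effectors on threats
  neutralized meanwhile are lost, so the total on a surviving subset may fall below
  \<open>C\<close>; hence the inequality in the assumption.\<close>

lemma fair_value_le_steps:
  assumes "0 \<le> q" "q < 1" "C \<ge> 1" "finite M" "(\<Sum>i\<in>M. x i) \<le> C"
  shows "fair_value q C (card M) \<le>
    real K + surv_mean (\<lambda>k. q ^ (K * x k)) M (\<lambda>B. fair_value q C (card B))"
  using assms(4,5)
proof (induction K arbitrary: M)
  case 0
  then show ?case by (simp add: surv_mean_one)
next
  case (Suc K)
  let ?v = "fair_value q C"
  have "?v (card M) \<le> 1 + surv_mean (\<lambda>k. q ^ x k) M (\<lambda>B. ?v (card B))"
    using Suc assms by (intro fair_value_le_step) auto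
  also have "surv_mean (\<lambda>k. q ^ x k) M (\<lambda>B. ?v (card B)) \<le>
      surv_mean (\<lambda>k. q ^ x k) M (\<lambda>B. real K + surv_mean (\<lambda>k. q ^ (K * x k)) B (\<lambda>B. ?v (card B)))"
    using Suc.prems by (intro surv_mean_mono Suc.IH)
      (auto intro: finite_subset sum_mono2[THEN order_trans])
  also have "\<dots> = real K + surv_mean (\<lambda>k. q ^ x k * q ^ (K * x k)) M (\<lambda>B. ?v (card B))"
    using Suc.prems assms by (subst surv_mean_mult[symmetric]) (auto simp: power_le_one)
  finally show ?case by (simp add: power_add)
qed


section \<open>Pathwise bounds: total work and the waste of fair policies\<close>

lemma active_subset: "active n \<pi> L t \<subseteq> {1..n}"
  by (induction n \<pi> L t rule: active.induct) auto

lemma defused_iff_active: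
  assumes "\<forall>i\<in>{1..n}. 1 \<le> L i"
  shows "defused n \<pi> L t \<longleftrightarrow> active n \<pi> L (Suc t) = {}"
  unfolding active_Suc[OF assms] defused_def by (auto simp: not_less)

lemma defused_iff_ge:
  assumes "\<pi> \<in> policies n C" "C \<ge> 1" "\<forall>i\<in>{1..n}. 1 \<le> L i"
  shows "defused n \<pi> L t \<longleftrightarrow> defusing_time n \<pi> L \<le> t"
proof
  show "defused n \<pi> L t \<Longrightarrow> defusing_time n \<pi> L \<le> t"
    unfolding defusing_time_def by (rule Least_le)
  assume "defusing_time n \<pi> L \<le> t"
  then have "(\<Sum>l=1..defusing_time n \<pi> L. alloc n \<pi> L l i) \<le> (\<Sum>l=1..t. alloc n \<pi> L l i)" for i
    by (intro sum_mono2) auto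
  then show "defused n \<pi> L t"
    using defusing_time_le(1)[OF assms] unfolding defused_def by (meson order_trans)
qed

lemma sum_alloc_le:
  assumes "\<pi> \<in> policies n C" "t \<ge> 1"
  shows "(\<Sum>i\<in>{1..n}. alloc n \<pi> L t i) \<le> C"
  using assms active_subset[of n \<pi> L t] unfolding policies_def alloc_def by blast

lemma sum_demand_le:
  assumes "\<pi> \<in> policies n C" "C \<ge> 1" "\<forall>i\<in>{1..n}. 1 \<le> L i"
  shows "(\<Sum>i=1..n. L i) \<le> C * defusing_time n \<pi> L"
proof -
  let ?T = "defusing_time n \<pi> L"
  have "(\<Sum>i=1..n. L i) \<le> (\<Sum>i=1..n. \<Sum>l=1..?T. alloc n \<pi> L l i)"
    using defusing_time_le(1)[OF assms] by (intro sum_mono) (auto simp: defused_def)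
  also have "\<dots> = (\<Sum>l=1..?T. \<Sum>i=1..n. alloc n \<pi> L l i)" by (rule sum.swap)
  also have "\<dots> \<le> (\<Sum>l=1..?T. C)" using sum_alloc_le[OF assms(1)] by (intro sum_mono) auto
  finally show ?thesis by (simp add: mult.commute)
qed

text \<open>Each of the \<open>m - m'\<close> terms of the harmonic difference is at least
  \<open>1 / m\<close>. This measures the potential released when the number of active threats drops
  from \<open>m\<close> to \<open>m'\<close> in one round.\<close>

lemma harm_diff_ge: "m' \<le> m \<Longrightarrow> real (m - m') / real m \<le> harm m - harm m'"
proof (induction m)
  case (Suc m)
  show ?case
  proof (cases "m' = Suc m")
    case False
    then have le: "m' \<le> m" using Suc.prems by simp
    have "real (Suc m - m') / real (Suc m) = real (m - m') / real (Suc m) + 1 / real (Suc m)"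
      using le by (simp add: Suc_diff_le add_divide_distrib[symmetric])
    also have "real (m - m') / real (Suc m) \<le> real (m - m') / real m"
      using le by (cases "m = 0") (auto intro!: divide_left_mono)
    finally show ?thesis using Suc.IH[OF le] by (simp add: harm_Suc inverse_eq_divide)
  qed simp
qed simp

text \<open>\<open>harm m - ln m\<close> is decreasing in \<open>m\<close> and equals 1 at
  \<open>m = 1\<close>.\<close>

lemma harm_le_ln: "m \<ge> 1 \<Longrightarrow> harm m \<le> 1 + ln (real m)"
  using decseqD[OF decseq_harm_diff_ln, of 0 "m - 1"] by (simp add: harm_def)

lemma fair_le_Suc: "fair n C M x \<Longrightarrow> i \<in> M \<Longrightarrow> j \<in> M \<Longrightarrow> x i \<le> Suc (x j)"
  unfolding fair_def by force

text \<open>By fairness every active threat gets at least \<open>x i - 1\<close> effectors and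
  \<open>i\<close> itself gets one more, which together cannot exceed \<open>C\<close>.\<close>

lemma fair_excess:
  assumes "fair n C M x" "finite M" "i \<in> M" "x i \<ge> 1"
  shows "card M * (x i - 1) \<le> C - 1"
proof -
  have le: "x i - 1 \<le> x j" if "j \<in> M" for j
    using fair_le_Suc[OF assms(1,3) that] by simp
  have "card M * (x i - 1) + 1 = (\<Sum>j\<in>M. x i - 1) + 1" by simp
  also have "\<dots> = (\<Sum>j\<in>M - {i}. x i - 1) + x i"
    using sum.remove[OF assms(2,3), of "\<lambda>_. x i - 1"] assms(4) by linarith
  also have "\<dots> \<le> (\<Sum>j\<in>M - {i}. x j) + x i" by (intro add_right_mono sum_mono le) auto
  also have "\<dots> = C" using assms by (simp add: fair_def sum.remove[of M i])
  finally show ?thesis by simp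
qed

text \<open>The invariant over the first \<open>t\<close> rounds charges the excess on neutralized
  threats to the drop of a potential \<open>h\<close> of the number of active threats. At the
  defusing time the active set is empty and the potential has dropped by
  \<open>harm (min n C)\<close>.\<close>

lemma fair_total_alloc_le:
  assumes "C \<ge> 1" "\<pi> \<in> fair_policies n C" "\<forall>i\<in>{1..n}. 1 \<le> L i"
  shows "real C * real (defusing_time n \<pi> L) \<le>
    real (\<Sum>i=1..n. L i) + (real C - 1) * harm (min n C)"
proof -
  have pol: "\<pi> \<in> policies n C" using assms(2) by (simp add: fair_policies_def)
  let ?T = "defusing_time n \<pi> L"
  define A where "A t = active n \<pi> L (Suc t)" for t
  define c where "c t i = (\<Sum>l=1..t. alloc n \<pi> L l i)" for t i
  \<comment> \<open>Truncated at \<open>C\<close>, because a fair round with more than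
    \<open>C\<close> active threats gives none of them more than one effector and so wastes
    nothing.\<close>
  define h :: "nat \<Rightarrow> real" where "h k = harm (min k C)" for k
  have A: "A t = {i\<in>{1..n}. c t i < L i}" for t
    unfolding A_def c_def by (rule active_Suc[OF assms(3)])
  have c_Suc: "c (Suc t) i = c t i + alloc n \<pi> L (Suc t) i" for t i
    by (simp add: c_def)
  have "(\<Sum>i=1..n. c t i) = C * t \<and>
      (\<Sum>i\<in>{1..n} - A t. real (c t i) - real (L i)) \<le> (real C - 1) * (h n - h (card (A t)))"
    if "t \<le> ?T" for t
    using that
  proof (induction t)
    case 0
    have "A 0 = {1..n}" using assms(3) by (auto simp: A c_def)
    then show ?case by (simp add: c_def)
  next
    case (Suc t)
    let ?m = "card (A t)" and ?m' = "card (A (Suc t))"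
    define x where "x = alloc n \<pi> L (Suc t)"
    have "A t \<noteq> {}"
      using Suc.prems defused_iff_active[OF assms(3)] defused_iff_ge[OF pol assms(1,3)]
      unfolding A_def by auto
    then have fair: "fair n C (A t) x"
      using assms(2) active_subset unfolding fair_policies_def x_def alloc_def A_def by auto
    have fin: "finite (A t)" and m: "?m > 0" and sub: "A t \<subseteq> {1..n}" "A (Suc t) \<subseteq> A t"
      using \<open>A t \<noteq> {}\<close> by (auto simp: A c_Suc card_gt_0_iff)
    have zero: "x i = 0" if "i \<in> {1..n} - A t" for i
      using fair that by (simp add: fair_def)
    have "(\<Sum>i=1..n. c (Suc t) i) = C * t + (\<Sum>i=1..n. x i)"
      using Suc by (simp add: c_Suc sum.distrib x_def)
    also have "(\<Sum>i=1..n. x i) = (\<Sum>i\<in>A t. x i)"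
      using sub zero by (intro sum.mono_neutral_right) auto
    finally have total: "(\<Sum>i=1..n. c (Suc t) i) = C * Suc t"
      using fair by (simp add: fair_def)
    define D where "D = (if ?m \<le> C then 1 / real ?m else 0)"
    have excess: "real (c (Suc t) i) - real (L i) \<le> (real C - 1) * D" if i: "i \<in> A t - A (Suc t)" for i
    proof -
      \<comment> \<open>The threat still lacked at least one effector when the round began, so its
        excess is at most \<open>x i - 1\<close>.\<close>
      have i': "c t i < L i" "L i \<le> c t i + x i" using i by (auto simp: A c_Suc x_def)
      then have x1: "x i \<ge> 1" by simp
      have le: "?m * (x i - 1) \<le> C - 1" using fair_excess[OF fair fin _ x1] i by auto
      have "real (x i - 1) \<le> (real C - 1) * D"
      proof (cases "?m \<le> C")
        case True
        have "real ?m * real (x i - 1) \<le> real C - 1"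
          using le assms(1) by (metis of_nat_1 of_nat_diff of_nat_le_iff of_nat_mult)
        then show ?thesis using m True by (simp add: D_def field_simps)
      next
        case False
        then have "?m * (x i - 1) < ?m * 1" using le assms(1) by linarith
        then have "x i - 1 = 0" by (simp only: mult_less_cancel1) auto
        then show ?thesis by (simp add: D_def False)
      qed
      moreover have "real (c (Suc t) i) = real (c t i) + real (x i)" by (simp add: c_Suc x_def)
      ultimately show ?thesis using i' x1 by linarith
    qed
    have "{1..n} - A (Suc t) = ({1..n} - A t) \<union> (A t - A (Suc t))" using sub by auto
    then have "(\<Sum>i\<in>{1..n} - A (Suc t). real (c (Suc t) i) - real (L i)) =
        (\<Sum>i\<in>{1..n} - A t. real (c (Suc t) i) - real (L i)) +
        (\<Sum>i\<in>A t - A (Suc t). real (c (Suc t) i) - real (L i))"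
      using fin by (auto intro: sum.union_disjoint)
    \<comment> \<open>Threats neutralized earlier receive nothing from a fair policy, so their
      excess stays frozen.\<close>
    also have "(\<Sum>i\<in>{1..n} - A t. real (c (Suc t) i) - real (L i)) =
        (\<Sum>i\<in>{1..n} - A t. real (c t i) - real (L i))"
      using zero by (intro sum.cong) (auto simp: c_Suc x_def)
    also have "\<dots> \<le> (real C - 1) * (h n - h ?m)" using Suc by simp
    also have "(\<Sum>i\<in>A t - A (Suc t). real (c (Suc t) i) - real (L i)) \<le> (\<Sum>i\<in>A t - A (Suc t). (real C - 1) * D)"
      by (intro sum_mono excess)
    also have "\<dots> = (real C - 1) * (real (?m - ?m') * D)"
      using sub fin by (simp add: card_Diff_subset finite_subset)
    also have "\<dots> \<le> (real C - 1) * (h ?m - h ?m')"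
    proof (rule mult_left_mono)
      \<comment> \<open>For \<open>?m \<le> C\<close> the truncation in \<open>h\<close> has no
        effect and \<open>harm_diff_ge\<close> applies; otherwise \<open>D = 0\<close> and
        monotonicity of \<open>h\<close> suffices.\<close>
      have "?m' \<le> ?m" using sub fin by (simp add: card_mono)
      then show "real (?m - ?m') * D \<le> h ?m - h ?m'"
        using harm_diff_ge[of ?m' ?m] by (auto simp: D_def h_def intro!: harm_mono)
    qed (use assms in simp)
    finally show ?case using total by (simp add: algebra_simps)
  qed
  from this[of ?T] have T: "(\<Sum>i=1..n. c ?T i) = C * ?T"
    "(\<Sum>i\<in>{1..n} - A ?T. real (c ?T i) - real (L i)) \<le> (real C - 1) * (h n - h (card (A ?T)))"
    by auto
  have "A ?T = {}"
    using defused_iff_active[OF assms(3)] defused_iff_ge[OF pol assms(1,3)] unfolding A_def by auto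
  then have "(\<Sum>i=1..n. real (c ?T i) - real (L i)) \<le> (real C - 1) * harm (min n C)"
    using T(2) by (simp add: h_def harm_def)
  moreover have "(\<Sum>i=1..n. real (c ?T i)) = real C * real ?T"
    using arg_cong[OF T(1), of real] by simp
  ultimately show ?thesis by (simp add: sum_subtractf)
qed

lemma fair_defusing_time_le:
  assumes "n \<ge> 1" "C \<ge> 1" "\<pi> \<in> fair_policies n C" "\<forall>i\<in>{1..n}. 1 \<le> L i"
  shows "real (defusing_time n \<pi> L) \<le> real (\<Sum>i=1..n. L i) / real C + (ln (real (min n C)) + 1)"
proof -
  have "(real C - 1) * harm (min n C) \<le> real C * (ln (real (min n C)) + 1)"
    using assms harm_le_ln[of "min n C"] harm_nonneg[of "min n C"] by (intro mult_mono) auto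
  then have "real C * real (defusing_time n \<pi> L) \<le>
      real (\<Sum>i=1..n. L i) + real C * (ln (real (min n C)) + 1)"
    using fair_total_alloc_le[OF assms(2-4)] by linarith
  then show ?thesis using assms by (simp add: field_simps)
qed

text \<open>The denominator is bounded below twice: by the total demand over \<open>C\<close>, which
  absorbs the leading term, and by \<open>n / C\<close>, as every demand is at least 1, which
  controls the additive term.\<close>

lemma fair_competitive_ratio:
  assumes "n \<ge> 1" "C \<ge> 1" "\<pi> \<in> fair_policies n C" "\<forall>i\<in>{1..n}. 1 \<le> L i"
  shows "real (defusing_time n \<pi> L) / of_int \<lceil>(1 / real C) * real (\<Sum>i=1..n. L i)\<rceil>
    \<le> 1 + (real C * ln (real (min n C)) + 2 * real C) / real n"
proof -
  let ?S = "real (\<Sum>i=1..n. L i)" and ?T = "real (defusing_time n \<pi> L)"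
  define c where "c = real_of_int \<lceil>(1 / real C) * ?S\<rceil>"
  have ln: "0 \<le> ln (real (min n C))" using assms by simp
  have "(\<Sum>i=1..n. 1) \<le> (\<Sum>i=1..n. L i)" using assms(4) by (intro sum_mono) auto
  then have S: "real n \<le> ?S" unfolding of_nat_le_iff by simp
  have "?S / real C \<le> c" using le_of_int_ceiling[of "?S / real C"] by (simp add: c_def)
  moreover have "real n / real C \<le> ?S / real C" using S by (intro divide_right_mono) auto
  moreover have pos: "0 < real n / real C" using assms by simp
  ultimately have c: "?S / real C \<le> c" "real n / real C \<le> c" "0 < c" by linarith+
  have "?T / c \<le> (c + (ln (real (min n C)) + 1)) / c"
    using fair_defusing_time_le[OF assms] c by (intro divide_right_mono; linarith)
  also have "\<dots> = 1 + (ln (real (min n C)) + 1) / c" using c by (simp add: add_divide_distrib)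
  also have "(ln (real (min n C)) + 1) / c \<le> (ln (real (min n C)) + 1) / (real n / real C)"
    using c ln pos by (intro divide_left_mono mult_pos_pos) linarith+
  also have "\<dots> \<le> (real C * ln (real (min n C)) + 2 * real C) / real n"
    using assms by (simp add: field_simps)
  finally show ?thesis by (simp add: c_def)
qed


section \<open>Memorylessness and the Markov chain of active sets\<close>

abbreviation demand1 :: "real \<Rightarrow> nat pmf" where
  "demand1 q \<equiv> map_pmf Suc (geometric_pmf (1 - q))"

text \<open>Memorylessness in terms of truncated subtraction: with probability \<open>q ^ k\<close>
  the demand exceeds \<open>k\<close> and the remainder is a fresh copy, otherwise it is 0. As
  \<open>demand1\<close> is positive, 0 marks exactly the neutralized threats.\<close>

lemma demand1_minus:
  assumes "0 \<le> q" "q < 1"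
  shows "map_pmf (\<lambda>r. r - k) (demand1 q) =
    bernoulli_pmf (q ^ k) \<bind> (\<lambda>b. if b then demand1 q else return_pmf 0)"
proof (rule pmf_eqI)
  fix j
  let ?p = "geometric_pmf (1 - q)"
  have p: "pmf ?p m = q ^ m * (1 - q)" for m using assms by simp
  have qk: "0 \<le> q ^ k" "q ^ k \<le> 1" using assms by (auto intro: power_le_one)
  have L: "pmf (map_pmf (\<lambda>r. r - k) (demand1 q)) j = measure_pmf.prob ?p {r. Suc r - k = j}"
    by (simp add: pmf_map vimage_def map_pmf_comp)
  have R: "pmf (bernoulli_pmf (q ^ k) \<bind> (\<lambda>b. if b then demand1 q else return_pmf 0)) j =
      q ^ k * pmf (demand1 q) j + (1 - q ^ k) * (if j = 0 then 1 else 0)"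
    using qk by (simp add: pmf_bind integral_measure_pmf[where A = UNIV] UNIV_bool)
  have "measure_pmf.prob ?p {r. Suc r - k = j} =
      q ^ k * pmf (demand1 q) j + (1 - q ^ k) * (if j = 0 then 1 else 0)"
  proof (cases j)
    case 0
    have "{r. Suc r - k = j} = {..<k}" using 0 by auto
    moreover have "(\<Sum>m<k. q ^ m * (1 - q)) = 1 - q ^ k"
      by (induction k) (simp_all add: algebra_simps)
    moreover have "pmf (demand1 q) 0 = 0" by (simp add: pmf_map vimage_def)
    ultimately show ?thesis using 0 by (simp add: p measure_measure_pmf_finite)
  next
    case (Suc i)
    have "{r. Suc r - k = j} = {i + k}" using Suc by auto
    moreover have "pmf (demand1 q) (Suc i) = pmf ?p i" by (simp add: pmf_map_inj')
    ultimately show ?thesis using Suc by (simp add: p measure_pmf_single power_add)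
  qed
  then show "pmf (map_pmf (\<lambda>r. r - k) (demand1 q)) j =
      pmf (bernoulli_pmf (q ^ k) \<bind> (\<lambda>b. if b then demand1 q else return_pmf 0)) j"
    unfolding L R .
qed

lemma Pi_pmf_map_dependent:
  assumes "finite A" "\<And>x. f x d = d'"
  shows "Pi_pmf A d' (\<lambda>x. map_pmf (f x) (g x)) = map_pmf (\<lambda>h x. f x (h x)) (Pi_pmf A d g)"
proof -
  have "Pi_pmf A d' (\<lambda>x. map_pmf (f x) (g x)) =
      Pi_pmf A d g \<bind> (\<lambda>h. return_pmf (\<lambda>x. if x \<in> A then f x (h x) else d'))"
    unfolding map_pmf_def using assms by (subst Pi_pmf_bind[where d' = d]) auto
  also have "\<dots> = map_pmf (\<lambda>h x. f x (h x)) (Pi_pmf A d g)"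
    unfolding map_pmf_def using set_Pi_pmf_subset[OF assms(1), of d g] assms(2)
    by (intro bind_pmf_cong refl arg_cong[of _ _ return_pmf]) (auto simp: fun_eq_iff)
  finally show ?thesis .
qed

text \<open>Each coordinate splits into a survival coin and a fresh demand. Drawing all coins first
  produces \<open>survivors\<close>; coordinates whose coin fails take the default value 0.\<close>

lemma Pi_demand1_minus:
  assumes "finite B" "\<And>i. i \<in> B \<Longrightarrow> q i \<in> {0..<1}"
  shows "map_pmf (\<lambda>f i. f i - x i) (Pi_pmf B 0 (\<lambda>i. demand1 (q i))) =
    survivors (\<lambda>i. q i ^ x i) B \<bind> (\<lambda>B'. Pi_pmf B' 0 (\<lambda>i. demand1 (q i)))"
proof -
  have "map_pmf (\<lambda>f i. f i - x i) (Pi_pmf B 0 (\<lambda>i. demand1 (q i))) =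
      Pi_pmf B 0 (\<lambda>i. map_pmf (\<lambda>r. r - x i) (demand1 (q i)))"
    using assms(1) by (subst Pi_pmf_map_dependent) auto
  also have "\<dots> = Pi_pmf B 0 (\<lambda>i. bernoulli_pmf (q i ^ x i) \<bind>
      (\<lambda>b. if b then demand1 (q i) else return_pmf 0))"
    using assms by (intro Pi_pmf_cong) (auto intro!: demand1_minus)
  also have "\<dots> = Pi_pmf B False (\<lambda>i. bernoulli_pmf (q i ^ x i)) \<bind>
      (\<lambda>s. Pi_pmf {i\<in>B. s i} 0 (\<lambda>i. demand1 (q i)))"
    using assms(1) by (subst Pi_pmf_bind[where d' = False]) (auto simp: Pi_pmf_if_set)
  finally show ?thesis by (simp add: survivors_def bind_map_pmf)
qed

text \<open>The index counts completed rounds, so state \<open>t\<close> corresponds to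
  \<open>active\<close> at \<open>Suc t\<close> and the next transition uses
  \<open>\<pi> (Suc t)\<close>.\<close>

primrec active_chain :: "nat \<Rightarrow> policy \<Rightarrow> (nat \<Rightarrow> real) \<Rightarrow> nat \<Rightarrow> nat set pmf" where
  "active_chain n \<pi> q 0 = return_pmf {1..n}"
| "active_chain n \<pi> q (Suc t) =
     active_chain n \<pi> q t \<bind> (\<lambda>B. survivors (\<lambda>i. q i ^ \<pi> (Suc t) B i) B)"

lemma set_active_chain: "set_pmf (active_chain n \<pi> q t) \<subseteq> Pow {1..n}"
proof (induction t)
  case (Suc t)
  then show ?case using set_survivors by (fastforce simp del: atLeastAtMost_iff)
qed simp

lemma finite_active_chain: "finite (set_pmf (active_chain n \<pi> q t))"
  by (rule finite_subset[OF set_active_chain]) simp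

lemma set_demand_pmf: "L \<in> set_pmf (demand_pmf n q) \<Longrightarrow> \<forall>i\<in>{1..n}. 1 \<le> L i"
  by (fastforce simp: demand_pmf_def set_Pi_pmf PiE_dflt_def)

lemma support_Pi_demand1:
  assumes "f \<in> set_pmf (Pi_pmf B 0 (\<lambda>i. demand1 (q i)))" "finite B"
  shows "{j. f j > 0} = B"
proof -
  have "f j > 0 \<longleftrightarrow> j \<in> B" for j
    using assms by (cases "j \<in> B") (fastforce simp: set_Pi_pmf PiE_dflt_def)+
  then show ?thesis by auto
qed

text \<open>Set to 0 outside \<open>{1..n}\<close>, where \<open>demand_pmf\<close> has the default
  1, so that the active set is exactly the support of the residual demand.\<close>

definition residual :: "nat \<Rightarrow> policy \<Rightarrow> (nat \<Rightarrow> nat) \<Rightarrow> nat \<Rightarrow> nat \<Rightarrow> nat" where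
  "residual n \<pi> L t i = (if i \<in> {1..n} then L i - (\<Sum>l=1..t. alloc n \<pi> L l i) else 0)"

lemma active_eq_residual:
  assumes "\<forall>i\<in>{1..n}. 1 \<le> L i"
  shows "active n \<pi> L (Suc t) = {i. residual n \<pi> L t i > 0}"
  unfolding active_Suc[OF assms] residual_def by auto

text \<open>
  The Markov property: given the active set, the residual demands of the active threats are again
  independent and geometric, because the geometric distribution is memoryless.
\<close>

lemma residual_law:
  assumes "\<And>i. i \<in> {1..n} \<Longrightarrow> q i \<in> {0..<1}"
  shows "map_pmf (\<lambda>L. residual n \<pi> L t) (demand_pmf n q) =
    active_chain n \<pi> q t \<bind> (\<lambda>B. Pi_pmf B 0 (\<lambda>i. demand1 (q i)))"
proof (induction t)
  case 0
  have "map_pmf (\<lambda>L. residual n \<pi> L 0) (demand_pmf n q) =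
      map_pmf (\<lambda>f x. if x \<in> {1..n} then f x else 0) (demand_pmf n q)"
    by (intro map_pmf_cong) (auto simp: residual_def fun_eq_iff)
  also have "\<dots> = Pi_pmf {1..n} 0 (\<lambda>i. demand1 (q i))"
    unfolding demand_pmf_def by (rule Pi_pmf_default_swap) simp
  finally show ?case by (simp add: bind_return_pmf)
next
  case (Suc t)
  \<comment> \<open>One round as a function of the residual demands alone: the active set that the
    policy needs is read off as their support.\<close>
  define F where "F f i = f i - \<pi> (Suc t) {j. f j > 0} i" for f :: "nat \<Rightarrow> nat" and i
  let ?G = "\<lambda>B. Pi_pmf B 0 (\<lambda>i. demand1 (q i))"
  have "map_pmf (\<lambda>L. residual n \<pi> L (Suc t)) (demand_pmf n q) =
      map_pmf (\<lambda>L. F (residual n \<pi> L t)) (demand_pmf n q)"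
  proof (rule map_pmf_cong[OF refl])
    fix L assume "L \<in> set_pmf (demand_pmf n q)"
    then have "alloc n \<pi> L (Suc t) = \<pi> (Suc t) {i. residual n \<pi> L t i > 0}"
      unfolding alloc_def by (subst active_eq_residual) (auto dest: set_demand_pmf)
    then show "residual n \<pi> L (Suc t) = F (residual n \<pi> L t)"
      by (auto simp: residual_def F_def fun_eq_iff)
  qed
  also have "\<dots> = map_pmf F (active_chain n \<pi> q t \<bind> ?G)"
    by (simp add: Suc[symmetric] map_pmf_comp)
  also have "\<dots> = active_chain n \<pi> q t \<bind>
      (\<lambda>B. survivors (\<lambda>i. q i ^ \<pi> (Suc t) B i) B \<bind> ?G)"
    unfolding map_bind_pmf
  proof (rule bind_pmf_cong[OF refl])
    fix B assume "B \<in> set_pmf (active_chain n \<pi> q t)"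
    then have B: "B \<subseteq> {1..n}" "finite B"
      using set_active_chain finite_subset[of B "{1..n}"] by blast+
    have "map_pmf F (?G B) = map_pmf (\<lambda>f i. f i - \<pi> (Suc t) B i) (?G B)"
    proof (rule map_pmf_cong[OF refl])
      fix f assume "f \<in> set_pmf (?G B)"
      then have "{j. f j > 0} = B"
        using B by (intro support_Pi_demand1)
      then show "F f = (\<lambda>i. f i - \<pi> (Suc t) B i)" by (simp add: F_def fun_eq_iff)
    qed
    also have "\<dots> = survivors (\<lambda>i. q i ^ \<pi> (Suc t) B i) B \<bind> ?G"
      using B assms by (intro Pi_demand1_minus) blast+
    finally show "map_pmf F (?G B) = survivors (\<lambda>i. q i ^ \<pi> (Suc t) B i) B \<bind> ?G" .
  qed
  finally show ?case by (simp add: bind_assoc_pmf)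
qed

text \<open>The active set is the support of the residual demand, and given state \<open>B\<close>
  of the chain that support is \<open>B\<close> because fresh demands are positive.\<close>

lemma active_law:
  assumes "\<And>i. i \<in> {1..n} \<Longrightarrow> q i \<in> {0..<1}"
  shows "map_pmf (\<lambda>L. active n \<pi> L (Suc t)) (demand_pmf n q) = active_chain n \<pi> q t"
proof -
  let ?G = "\<lambda>B. Pi_pmf B 0 (\<lambda>i. demand1 (q i))"
  have "map_pmf (\<lambda>L. active n \<pi> L (Suc t)) (demand_pmf n q) =
      map_pmf (\<lambda>f. {j. f j > 0}) (map_pmf (\<lambda>L. residual n \<pi> L t) (demand_pmf n q))"
    unfolding map_pmf_comp by (intro map_pmf_cong refl active_eq_residual set_demand_pmf)
  also have "\<dots> = active_chain n \<pi> q t \<bind> (\<lambda>B. map_pmf (\<lambda>f. {j. f j > 0}) (?G B))"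
    using assms by (subst residual_law) (auto simp: map_bind_pmf)
  also have "\<dots> = active_chain n \<pi> q t \<bind> (\<lambda>B. return_pmf B)"
  proof (rule bind_pmf_cong[OF refl])
    fix B assume "B \<in> set_pmf (active_chain n \<pi> q t)"
    then have B: "finite B"
      using set_active_chain finite_subset[of B "{1..n}"] by blast
    have "map_pmf (\<lambda>f. {j. f j > 0}) (?G B) = map_pmf (\<lambda>_. B) (?G B)"
      using B by (intro map_pmf_cong refl support_Pi_demand1)
    then show "map_pmf (\<lambda>f. {j. f j > 0}) (?G B) = return_pmf B" by (simp add: map_pmf_const)
  qed
  finally show ?thesis by (simp add: bind_return_pmf')
qed

lemma expectation_active_chain_Suc:
  "measure_pmf.expectation (active_chain n \<pi> q (Suc t)) f =
   measure_pmf.expectation (active_chain n \<pi> q t)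
     (\<lambda>B. surv_mean (\<lambda>i. q i ^ \<pi> (Suc t) B i) B f)" for f :: "nat set \<Rightarrow> real"
proof -
  have "measure_pmf.expectation (active_chain n \<pi> q (Suc t)) f =
      (\<Sum>B\<in>Pow {1..n}. pmf (active_chain n \<pi> q t) B *\<^sub>R
        surv_mean (\<lambda>i. q i ^ \<pi> (Suc t) B i) B f)"
    unfolding active_chain.simps using set_active_chain
    by (intro pmf_expectation_bind) (auto intro!: finite_set_survivors dest: finite_subset)
  also have "\<dots> = measure_pmf.expectation (active_chain n \<pi> q t)
     (\<lambda>B. surv_mean (\<lambda>i. q i ^ \<pi> (Suc t) B i) B f)"
    using set_active_chain by (intro integral_measure_pmf[symmetric]) (auto dest!: subsetD[OF set_active_chain])
  finally show ?thesis .
qed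


section \<open>Expected load and the performance ratio\<close>

lemma
  assumes "i \<in> {1..n}" "q i \<in> {0..<1}"
  shows integrable_demand: "integrable (demand_pmf n q) (\<lambda>L. real (L i))"
    and expectation_demand: "measure_pmf.expectation (demand_pmf n q) (\<lambda>L. real (L i)) = 1 / (1 - q i)"
proof -
  have comp: "map_pmf (\<lambda>L. L i) (demand_pmf n q) = demand1 (q i)"
    unfolding demand_pmf_def using assms by (subst Pi_pmf_component) auto
  have p: "1 - q i \<in> {0<..1}" using assms(2) by auto
  have int: "integrable (demand1 (q i)) real"
    using integrable_real_geometric_pmf[OF p] by simp
  then show "integrable (demand_pmf n q) (\<lambda>L. real (L i))"
    unfolding comp[symmetric] by simp
  have "measure_pmf.expectation (demand_pmf n q) (\<lambda>L. real (L i)) =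
      measure_pmf.expectation (demand1 (q i)) real"
    unfolding comp[symmetric] by simp
  also have "\<dots> = 1 + (1 - (1 - q i)) / (1 - q i)"
    using integrable_real_geometric_pmf[OF p] expectation_geometric_pmf[OF p] by simp
  also have "\<dots> = 1 / (1 - q i)" using assms(2) by (simp add: field_simps)
  finally show "measure_pmf.expectation (demand_pmf n q) (\<lambda>L. real (L i)) = 1 / (1 - q i)" .
qed

context
  fixes n C :: nat and q :: "nat \<Rightarrow> real"
  assumes n: "n \<ge> 1" and C: "C \<ge> 1" and q: "\<And>i. i \<in> {1..n} \<Longrightarrow> q i \<in> {0..<1}"
begin

lemma integrable_total_demand: "integrable (demand_pmf n q) (\<lambda>L. real (\<Sum>i=1..n. L i))"
  using integrable_demand[of _ n q] q by (auto intro!: Bochner_Integration.integrable_sum)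

lemma expectation_total_demand:
  "measure_pmf.expectation (demand_pmf n q) (\<lambda>L. real (\<Sum>i=1..n. L i)) = (\<Sum>i=1..n. 1 / (1 - q i))"
proof -
  have "measure_pmf.expectation (demand_pmf n q) (\<lambda>L. real (\<Sum>i=1..n. L i)) =
      measure_pmf.expectation (demand_pmf n q) (\<lambda>L. \<Sum>i=1..n. real (L i))" by simp
  also have "\<dots> = (\<Sum>i=1..n. measure_pmf.expectation (demand_pmf n q) (\<lambda>L. real (L i)))"
    using integrable_demand[of _ n q] q by (intro Bochner_Integration.integral_sum) auto
  also have "\<dots> = (\<Sum>i=1..n. 1 / (1 - q i))"
    using q by (intro sum.cong refl expectation_demand) auto
  finally show ?thesis .
qed

lemma integrable_defusing_time:
  assumes "\<pi> \<in> policies n C"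
  shows "integrable (demand_pmf n q) (\<lambda>L. real (defusing_time n \<pi> L))"
proof (rule Bochner_Integration.integrable_bound[OF integrable_total_demand])
  have "defusing_time n \<pi> L \<le> (\<Sum>i=1..n. L i)" if "L \<in> set_pmf (demand_pmf n q)" for L
    using defusing_time_le(2)[OF assms C set_demand_pmf[OF that]] .
  then show "AE L in demand_pmf n q. norm (real (defusing_time n \<pi> L)) \<le> norm (real (\<Sum>i=1..n. L i))"
    by (auto simp: AE_measure_pmf_iff simp flip: of_nat_sum)
qed simp

lemma expected_time_ge_load:
  assumes "\<pi> \<in> policies n C"
  shows "(\<Sum>i=1..n. 1 / (1 - q i)) / real C \<le> expected_time n \<pi> q"
proof -
  have "real (\<Sum>i=1..n. L i) / real C \<le> real (defusing_time n \<pi> L)"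
    if "L \<in> set_pmf (demand_pmf n q)" for L
  proof -
    have "real (\<Sum>i=1..n. L i) \<le> real (C * defusing_time n \<pi> L)"
      using sum_demand_le[OF assms C set_demand_pmf[OF that]] unfolding of_nat_le_iff .
    then show ?thesis using C by (simp add: field_simps)
  qed
  then have "measure_pmf.expectation (demand_pmf n q) (\<lambda>L. real (\<Sum>i=1..n. L i) / real C) \<le> expected_time n \<pi> q"
    unfolding expected_time_def
    by (intro integral_mono_AE Bochner_Integration.integrable_divide
        integrable_total_demand integrable_defusing_time[OF assms])
      (auto simp: AE_measure_pmf_iff)
  also have "measure_pmf.expectation (demand_pmf n q) (\<lambda>L. real (\<Sum>i=1..n. L i) / real C) =
      (\<Sum>i=1..n. 1 / (1 - q i)) / real C"
    unfolding expectation_total_demand[symmetric] by (rule integral_divide_zero)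
  finally show ?thesis .
qed

lemma fair_expected_time_le:
  assumes "\<pi> \<in> fair_policies n C"
  shows "expected_time n \<pi> q \<le> (\<Sum>i=1..n. 1 / (1 - q i)) / real C + (ln (real (min n C)) + 1)"
proof -
  have pol: "\<pi> \<in> policies n C" using assms by (simp add: fair_policies_def)
  have "expected_time n \<pi> q \<le> measure_pmf.expectation (demand_pmf n q)
      (\<lambda>L. real (\<Sum>i=1..n. L i) / real C + (ln (real (min n C)) + 1))"
    unfolding expected_time_def
    using fair_defusing_time_le[OF n C assms] set_demand_pmf[of _ n q]
    by (intro integral_mono_AE Bochner_Integration.integrable_add Bochner_Integration.integrable_divide
        integrable_total_demand integrable_defusing_time[OF pol] measure_pmf.integrable_const)
      (auto simp: AE_measure_pmf_iff simp del: of_nat_sum)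
  also have "\<dots> = measure_pmf.expectation (demand_pmf n q) (\<lambda>L. real (\<Sum>i=1..n. L i) / real C)
      + (ln (real (min n C)) + 1)"
    by (subst Bochner_Integration.integral_add[OF
          Bochner_Integration.integrable_divide[OF integrable_total_demand] measure_pmf.integrable_const])
      simp
  also have "measure_pmf.expectation (demand_pmf n q) (\<lambda>L. real (\<Sum>i=1..n. L i) / real C) =
      (\<Sum>i=1..n. 1 / (1 - q i)) / real C"
    unfolding expectation_total_demand[symmetric] by (rule integral_divide_zero)
  finally show ?thesis .
qed

text \<open>The policy \<open>\<pi>\<close> witnesses that the infimum is over a nonempty
  set.\<close>

lemma optimal_time_ge:
  assumes "\<pi> \<in> policies n C" "\<And>\<pi>. \<pi> \<in> policies n C \<Longrightarrow> c \<le> expected_time n \<pi> q"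
  shows "c \<le> optimal_time n C q"
  unfolding optimal_time_def using assms by (intro cINF_greatest) auto

text \<open>With \<open>S\<close> the expected total demand, every policy needs at least
  \<open>S / C\<close> and the fair one at most \<open>S / C + b\<close>, both obtained by
  integrating the pathwise bounds.\<close>

lemma fair_performance_ratio:
  assumes "\<pi> \<in> fair_policies n C"
  shows "expected_time n \<pi> q / optimal_time n C q
    \<le> 1 + (real C * ln (real (min n C)) + 2 * real C) / (\<Sum>i=1..n. 1 / (1 - q i))"
proof -
  have pol: "\<pi> \<in> policies n C" using assms by (simp add: fair_policies_def)
  define S where "S = (\<Sum>i=1..n. 1 / (1 - q i))"
  define b where "b = ln (real (min n C)) + 1"
  have S: "S > 0" unfolding S_def using n q by (intro sum_pos) auto
  have b: "b \<ge> 1" unfolding b_def using n C by simp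
  have opt: "S / real C \<le> optimal_time n C q"
    using pol expected_time_ge_load unfolding S_def by (intro optimal_time_ge) auto
  have SC: "0 < S / real C" using S C by simp
  have "expected_time n \<pi> q / optimal_time n C q \<le> (S / real C + b) / (S / real C)"
    using fair_expected_time_le[OF assms] opt SC b unfolding S_def[symmetric] b_def[symmetric]
    by (intro frac_le) linarith+
  also have "\<dots> = 1 + real C * b / S" using S C by (simp add: field_simps)
  also have "\<dots> \<le> 1 + (real C * (b + 1)) / S"
    using S by (intro add_left_mono divide_right_mono mult_left_mono) auto
  finally show ?thesis by (simp add: S_def b_def algebra_simps)
qed

section \<open>Potential functions and bounded difficulties\<close>

text \<open>Tail-sum formula: the defusing time counts the \<open>t\<close> at which the active set
  after \<open>t\<close> rounds is nonempty. Truncation at \<open>N\<close> keeps the sum finite;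
  dominated convergence removes it afterwards.\<close>

lemma expectation_min_defusing_time:
  assumes "\<pi> \<in> policies n C"
  shows "measure_pmf.expectation (demand_pmf n q) (\<lambda>L. real (min (defusing_time n \<pi> L) N)) =
    (\<Sum>t<N. measure_pmf.prob (active_chain n \<pi> q t) (- {{}}))"
proof -
  have "real (min (defusing_time n \<pi> L) N) = (\<Sum>t<N. indicat_real (- {{}}) (active n \<pi> L (Suc t)))"
    if "L \<in> set_pmf (demand_pmf n q)" for L
  proof -
    have "indicat_real (- {{}}) (active n \<pi> L (Suc t)) = (if t < defusing_time n \<pi> L then 1 else 0)" for t
      using defused_iff_active[OF set_demand_pmf[OF that]]
        defused_iff_ge[OF assms C set_demand_pmf[OF that]] by (auto simp: indicator_def not_less)
    then have "(\<Sum>t<N. indicat_real (- {{}}) (active n \<pi> L (Suc t))) =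
        (\<Sum>t<N. if t < defusing_time n \<pi> L then 1 else 0)" by simp
    also have "\<dots> = real (card ({..<N} \<inter> {t. t < defusing_time n \<pi> L}))"
      by (simp add: sum.If_cases)
    also have "{..<N} \<inter> {t. t < defusing_time n \<pi> L} = {..<min (defusing_time n \<pi> L) N}" by auto
    finally show ?thesis by simp
  qed
  then have "measure_pmf.expectation (demand_pmf n q) (\<lambda>L. real (min (defusing_time n \<pi> L) N)) =
      measure_pmf.expectation (demand_pmf n q) (\<lambda>L. \<Sum>t<N. indicat_real (- {{}}) (active n \<pi> L (Suc t)))"
    by (intro integral_cong_AE) (auto simp: AE_measure_pmf_iff)
  also have "\<dots> = (\<Sum>t<N. measure_pmf.expectation (demand_pmf n q)
      (\<lambda>L. indicat_real (- {{}}) (active n \<pi> L (Suc t))))"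
    by (intro Bochner_Integration.integral_sum measure_pmf.integrable_const_bound[where B = 1]) auto
  also have "\<dots> = (\<Sum>t<N. measure_pmf.expectation
      (map_pmf (\<lambda>L. active n \<pi> L (Suc t)) (demand_pmf n q)) (indicat_real (- {{}})))"
    by (simp only: integral_map_pmf)
  also have "\<dots> = (\<Sum>t<N. measure_pmf.prob (active_chain n \<pi> q t) (- {{}}))"
    by (intro sum.cong refl) (subst active_law, use q in auto)
  finally show ?thesis .
qed

lemma expected_time_sums:
  assumes "\<pi> \<in> policies n C"
  shows "(\<lambda>t. measure_pmf.prob (active_chain n \<pi> q t) (- {{}})) sums expected_time n \<pi> q"
  unfolding sums_def expectation_min_defusing_time[OF assms, symmetric] expected_time_def
proof (rule integral_dominated_convergence[OF _ _ integrable_defusing_time[OF assms]])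
  have "(\<lambda>N. real (min (defusing_time n \<pi> L) N)) \<longlonglongrightarrow> real (defusing_time n \<pi> L)" for L
    by (rule tendsto_eventually) (auto simp: eventually_sequentially intro!: exI[of _ "defusing_time n \<pi> L"])
  then show "AE L in demand_pmf n q. (\<lambda>N. real (min (defusing_time n \<pi> L) N)) \<longlonglongrightarrow> real (defusing_time n \<pi> L)"
    by simp
qed auto

text \<open>A supermartingale argument: elapsed time plus the potential of the current state does
  not grow in mean. Nonnegativity of \<open>v\<close> allows the remaining potential to be dropped
  before \<open>N\<close> tends to infinity.\<close>

lemma expected_time_le_potential:
  fixes v :: "nat set \<Rightarrow> real"
  assumes "\<pi> \<in> policies n C" "\<And>B. B \<subseteq> {1..n} \<Longrightarrow> 0 \<le> v B"
    "\<And>t B. B \<subseteq> {1..n} \<Longrightarrow> B \<noteq> {} \<Longrightarrow> 1 + surv_mean (\<lambda>i. q i ^ \<pi> (Suc t) B i) B v \<le> v B"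
  shows "expected_time n \<pi> q \<le> v {1..n}"
proof -
  let ?X = "active_chain n \<pi> q"
  let ?E = "\<lambda>t. measure_pmf.expectation (?X t)"
  have int: "integrable (?X t) f" for t and f :: "nat set \<Rightarrow> real"
    by (intro integrable_measure_pmf_finite finite_active_chain)
  have nonneg: "0 \<le> ?E t v" for t
  proof (intro integral_nonneg_AE AE_pmfI)
    fix B assume "B \<in> set_pmf (?X t)"
    then have "B \<subseteq> {1..n}" using set_active_chain by blast
    then show "0 \<le> v B" by (rule assms(2))
  qed
  have "(\<Sum>t<N. measure_pmf.prob (?X t) (- {{}})) + ?E N v \<le> v {1..n}" for N
  proof (induction N)
    case (Suc N)
    have "measure_pmf.prob (?X N) (- {{}}) + ?E (Suc N) v =
        ?E N (\<lambda>B. indicat_real (- {{}}) B + surv_mean (\<lambda>i. q i ^ \<pi> (Suc N) B i) B v)"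
      unfolding expectation_active_chain_Suc by (simp add: Bochner_Integration.integral_add[OF int int])
    also have "\<dots> \<le> ?E N v"
    proof (intro integral_mono_AE int AE_pmfI)
      fix B assume "B \<in> set_pmf (?X N)"
      then have "B \<subseteq> {1..n}" using set_active_chain by blast
      then show "indicat_real (- {{}}) B + surv_mean (\<lambda>i. q i ^ \<pi> (Suc N) B i) B v \<le> v B"
        using assms(3) by (cases "B = {}") auto
    qed
    finally show ?case using Suc by simp
  qed simp
  then have "(\<Sum>t<N. measure_pmf.prob (?X t) (- {{}})) \<le> v {1..n}" for N
    using nonneg[of N] by (smt (verit))
  then show ?thesis
    using expected_time_sums[OF assms(1)] unfolding sums_def by (intro LIMSEQ_le_const2) auto
qed

text \<open>The submartingale counterpart, charging \<open>K\<close> per round. Here the remaining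
  potential must vanish: it is at most \<open>c\<close> times the probability of being unfinished, a
  term of a convergent series.\<close>

lemma potential_le_expected_time:
  fixes v :: "nat set \<Rightarrow> real"
  assumes "\<pi> \<in> policies n C" "v {} = 0" "\<And>B. B \<subseteq> {1..n} \<Longrightarrow> v B \<le> c"
    "\<And>t B. B \<subseteq> {1..n} \<Longrightarrow> B \<noteq> {} \<Longrightarrow> v B \<le> K + surv_mean (\<lambda>i. q i ^ \<pi> (Suc t) B i) B v"
  shows "v {1..n} \<le> K * expected_time n \<pi> q"
proof -
  let ?X = "active_chain n \<pi> q"
  let ?E = "\<lambda>t. measure_pmf.expectation (?X t)"
  let ?P = "\<lambda>t. measure_pmf.prob (?X t) (- {{}})"
  have int: "integrable (?X t) f" for t and f :: "nat set \<Rightarrow> real"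
    by (intro integrable_measure_pmf_finite finite_active_chain)
  have "v {1..n} \<le> K * (\<Sum>t<N. ?P t) + ?E N v" for N
  proof (induction N)
    case (Suc N)
    have "?E N v \<le> ?E N (\<lambda>B. K * indicat_real (- {{}}) B + surv_mean (\<lambda>i. q i ^ \<pi> (Suc N) B i) B v)"
    proof (intro integral_mono_AE int AE_pmfI)
      fix B assume "B \<in> set_pmf (?X N)"
      then have "B \<subseteq> {1..n}" using set_active_chain by blast
      then show "v B \<le> K * indicat_real (- {{}}) B + surv_mean (\<lambda>i. q i ^ \<pi> (Suc N) B i) B v"
        using assms(2,4) by (cases "B = {}") auto
    qed
    also have "\<dots> = K * ?P N + ?E (Suc N) v"
      unfolding expectation_active_chain_Suc by (subst Bochner_Integration.integral_add[OF int int]) simp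
    finally show ?case using Suc by (simp add: algebra_simps)
  qed simp
  moreover have "?E N v \<le> c * ?P N" for N
  proof -
    have "?E N v \<le> ?E N (\<lambda>B. c * indicat_real (- {{}}) B)"
      using set_active_chain[of n \<pi> q N] assms(2,3)
      by (intro integral_mono_AE int AE_pmfI) (auto simp: indicator_def)
    then show ?thesis by simp
  qed
  ultimately have le: "v {1..n} \<le> K * (\<Sum>t<N. ?P t) + c * ?P N" for N
    by (meson add_left_mono order_trans)
  have sums: "?P sums expected_time n \<pi> q" by (rule expected_time_sums[OF assms(1)])
  then have "(\<lambda>N. K * (\<Sum>t<N. ?P t) + c * ?P N) \<longlonglongrightarrow> K * expected_time n \<pi> q + c * 0"
    unfolding sums_def using summable_LIMSEQ_zero[OF sums_summable[OF sums]] by (intro tendsto_intros)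
  then show ?thesis using le by (intro LIMSEQ_le_const) auto
qed

text \<open>The potential is \<open>fair_value qu C (card B)\<close>. Raising all difficulties to
  \<open>qu\<close> only favours survival, and at difficulty \<open>qu\<close> a fair round
  satisfies the one-step equation exactly.\<close>

lemma fair_expected_time_le_fair_value:
  assumes "\<pi> \<in> fair_policies n C" "\<And>i. i \<in> {1..n} \<Longrightarrow> q i \<le> qu" "0 \<le> qu" "qu < 1"
  shows "expected_time n \<pi> q \<le> fair_value qu C n"
proof -
  have mono: "mono (fair_value qu C)" using assms C by (intro fair_value_mono)
  have "expected_time n \<pi> q \<le> fair_value qu C (card {1..n})"
  proof (rule expected_time_le_potential)
    show "\<pi> \<in> policies n C" using assms(1) by (simp add: fair_policies_def)
    show "0 \<le> fair_value qu C (card B)" for B :: "nat set"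
      using monoD[OF mono, of 0 "card B"] by simp
    fix t and B :: "nat set"
    assume B: "B \<subseteq> {1..n}" "B \<noteq> {}"
    let ?x = "\<pi> (Suc t) B"
    have fin: "finite B" using B finite_subset by blast
    have fair: "fair n C B ?x" using assms(1) B by (auto simp: fair_policies_def)
    have "surv_mean (\<lambda>i. q i ^ ?x i) B (\<lambda>B. fair_value qu C (card B))
        \<le> surv_mean (\<lambda>i. qu ^ ?x i) B (\<lambda>B. fair_value qu C (card B))"
    proof (rule surv_mean_mono_prob[OF fin _ _ _ mono])
      fix i assume "i \<in> B"
      then have "i \<in> {1..n}" using B by blast
      then have "0 \<le> q i" "q i < 1" "q i \<le> qu" using q[of i] assms(2)[of i] by simp_all
      then show "q i ^ ?x i \<in> {0..1}" "qu ^ ?x i \<in> {0..1}" "q i ^ ?x i \<le> qu ^ ?x i"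
        using assms(3,4) by (auto intro: power_le_one power_mono)
    qed
    also have "\<dots> = surv_mean (\<lambda>k. qu ^ balanced C (card B) k) {..<card B} (\<lambda>B. fair_value qu C (card B))"
      using assms(3,4) fin B mono fair fair_le_Suc[OF fair]
      by (intro surv_mean_fair_eq) (auto simp: fair_def)
    also have "1 + \<dots> = fair_value qu C (card B)"
      using fin B assms C by (intro fair_value_eq[symmetric]) (auto simp: card_gt_0_iff)
    finally show "1 + surv_mean (\<lambda>i. q i ^ ?x i) B (\<lambda>B. fair_value qu C (card B)) \<le> fair_value qu C (card B)"
      by simp
  qed
  then show ?thesis by simp
qed

text \<open>Since \<open>qu ^ (K * x) \<le> q i ^ x\<close>, one actual round leaves stochastically
  at least as many survivors as \<open>K\<close> rounds of the same allocation at difficulty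
  \<open>qu\<close>; hence the charge of \<open>K\<close> per round.\<close>

lemma fair_value_le_expected_time:
  assumes "\<pi> \<in> policies n C" "\<And>i. i \<in> {1..n} \<Longrightarrow> qu ^ K \<le> q i" "0 \<le> qu" "qu < 1"
  shows "fair_value qu C n \<le> real K * expected_time n \<pi> q"
proof -
  have mono: "mono (fair_value qu C)" using assms C by (intro fair_value_mono)
  have "fair_value qu C (card {1..n}) \<le> real K * expected_time n \<pi> q"
  proof (rule potential_le_expected_time[OF assms(1)])
    show "fair_value qu C (card B) \<le> fair_value qu C n" if "B \<subseteq> {1..n}" for B
      using mono card_mono[OF _ that] by (auto dest: monoD)
    fix t and B :: "nat set"
    assume B: "B \<subseteq> {1..n}" "B \<noteq> {}"
    let ?x = "\<pi> (Suc t) B"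
    have fin: "finite B" using B finite_subset by blast
    have "(\<Sum>i\<in>B. ?x i) = C" using assms(1) B by (auto simp: policies_def)
    then have "fair_value qu C (card B) \<le>
        real K + surv_mean (\<lambda>i. qu ^ (K * ?x i)) B (\<lambda>B. fair_value qu C (card B))"
      using assms C fin by (intro fair_value_le_steps) auto
    also have "surv_mean (\<lambda>i. qu ^ (K * ?x i)) B (\<lambda>B. fair_value qu C (card B))
        \<le> surv_mean (\<lambda>i. q i ^ ?x i) B (\<lambda>B. fair_value qu C (card B))"
    proof (rule surv_mean_mono_prob[OF fin _ _ _ mono])
      fix i assume "i \<in> B"
      then have "i \<in> {1..n}" using B by blast
      then have "0 \<le> q i" "q i < 1" "qu ^ K \<le> q i" using q[of i] assms(2)[of i] by simp_all
      then show "qu ^ (K * ?x i) \<in> {0..1}" "q i ^ ?x i \<in> {0..1}" "qu ^ (K * ?x i) \<le> q i ^ ?x i"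
        using assms(3,4) by (auto simp: power_mult intro!: power_le_one power_mono)
    qed
    finally show "fair_value qu C (card B) \<le>
        real K + surv_mean (\<lambda>i. q i ^ ?x i) B (\<lambda>B. fair_value qu C (card B))" by simp
  qed simp
  then show ?thesis by simp
qed

end

lemma fair_bounded_performance_ratio:
  fixes ql qu :: real
  assumes "n \<ge> 1" "C \<ge> 1" "\<pi> \<in> fair_policies n C" "0 < ql" "ql < qu" "qu < 1"
    "q \<in> {1..n} \<rightarrow> {ql..qu}"
  shows "expected_time n \<pi> q / optimal_time n C q \<le> of_int \<lceil>ln ql / ln qu\<rceil>"
proof -
  define K where "K = nat \<lceil>ln ql / ln qu\<rceil>"
  have ln: "ln qu < 0" "ln ql < 0" using assms by simp_all
  then have "0 < ln ql / ln qu" by (simp add: divide_neg_neg)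
  then have K: "real K = of_int \<lceil>ln ql / ln qu\<rceil>" "K > 0" by (auto simp: K_def)
  have "ln ql / ln qu \<le> real K" using K by simp
  \<comment> \<open>Multiplying by \<open>ln qu\<close>, which is negative, reverses the
    inequality.\<close>
  then have "ln (qu ^ K) \<le> ln ql"
    using ln assms by (simp add: ln_realpow neg_divide_le_eq)
  then have quK: "qu ^ K \<le> ql" using assms by simp
  have q01: "q i \<in> {0..<1}" and ql: "qu ^ K \<le> q i" and qu: "q i \<le> qu" if "i \<in> {1..n}" for i
  proof -
    have "ql \<le> q i" "q i \<le> qu" using PiE[OF assms(7), of i] that by auto
    then show "q i \<in> {0..<1}" "qu ^ K \<le> q i" "q i \<le> qu" using assms(4-6) quK by auto
  qed
  have pol: "\<pi> \<in> policies n C" using assms(3) by (simp add: fair_policies_def)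
  have "fair_value qu C n / real K \<le> expected_time n \<pi>' q" if "\<pi>' \<in> policies n C" for \<pi>'
    using fair_value_le_expected_time[OF assms(1,2) q01 that ql] assms K by (simp add: field_simps)
  then have opt: "fair_value qu C n / real K \<le> optimal_time n C q"
    using pol by (intro optimal_time_ge[OF assms(1,2) q01]) auto
  have fa: "expected_time n \<pi> q \<le> fair_value qu C n"
    using assms by (intro fair_expected_time_le_fair_value q01 qu) auto
  \<comment> \<open>The load bound makes the optimal time strictly positive, which justifies
    clearing the denominator of the ratio.\<close>
  have "(\<Sum>i=1..n. 1 / (1 - q i)) > 0" using assms q01 by (intro sum_pos) auto
  then have "0 < (\<Sum>i=1..n. 1 / (1 - q i)) / real C" using assms by simp
  then have "0 < optimal_time n C q"
    using pol expected_time_ge_load[OF assms(1,2) q01] optimal_time_ge[OF assms(1,2) q01 pol]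
    by (meson less_le_trans)
  then have "expected_time n \<pi> q / optimal_time n C q \<le> real K"
    using opt fa K(2) by (simp add: field_simps)
  then show ?thesis unfolding K(1) .
qed

text \<open>The suprema are taken in \<open>ereal\<close>, where they always exist, so each bound
  reduces to a pointwise one without a separate proof of boundedness.\<close>

theorem theorem3:
  fixes n C :: nat and \<pi> :: policy
  assumes "n \<ge> 1" and "C \<ge> 1" and "\<pi> \<in> fair_policies n C"
  shows
    "(SUP L\<in>{1..n} \<rightarrow> {1..}.
        ereal (real (defusing_time n \<pi> L) / of_int \<lceil>(1 / real C) * real (\<Sum>i=1..n. L i)\<rceil>))
       \<le> ereal (1 + (real C * ln (real (min n C)) + 2 * real C) / real n)
     \<and> (\<forall>q\<in>{1..n} \<rightarrow> {0..<1}.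
          expected_time n \<pi> q / optimal_time n C q
            \<le> 1 + (real C * ln (real (min n C)) + 2 * real C) / (\<Sum>i=1..n. 1 / (1 - q i)))
     \<and> (\<forall>ql qu :: real. 0 < ql \<and> ql < qu \<and> qu < 1 \<longrightarrow>
          (SUP q\<in>{1..n} \<rightarrow> {ql..qu}.
             ereal (expected_time n \<pi> q / optimal_time n C q))
            \<le> ereal (of_int \<lceil>ln ql / ln qu\<rceil>))"
proof (intro conjI ballI allI impI SUP_least)
  fix L assume "L \<in> {1..n} \<rightarrow> {1::nat..}"
  then have "\<forall>i\<in>{1..n}. 1 \<le> L i" by (auto simp: Pi_iff)
  then show "ereal (real (defusing_time n \<pi> L) / of_int \<lceil>(1 / real C) * real (\<Sum>i=1..n. L i)\<rceil>)
      \<le> ereal (1 + (real C * ln (real (min n C)) + 2 * real C) / real n)"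
    using fair_competitive_ratio[OF assms] by simp
next
  fix q assume "q \<in> {1..n} \<rightarrow> {0..<1::real}"
  then show "expected_time n \<pi> q / optimal_time n C q
      \<le> 1 + (real C * ln (real (min n C)) + 2 * real C) / (\<Sum>i=1..n. 1 / (1 - q i))"
    using assms by (intro fair_performance_ratio) (auto simp: Pi_iff)
next
  fix ql qu :: real and q
  assume "0 < ql \<and> ql < qu \<and> qu < 1" "q \<in> {1..n} \<rightarrow> {ql..qu}"
  then show "ereal (expected_time n \<pi> q / optimal_time n C q) \<le> ereal (of_int \<lceil>ln ql / ln qu\<rceil>)"
    using fair_bounded_performance_ratio[OF assms] by simp
qed

end
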